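(* For every $k\geq 3$, every $k$-rose graph is determined by its Laplacian spectrum.
   Context: Graphs are finite, simple and undirected. For $k\ge2$, a $k$-rose graph is a connected graph with one vertex of degree $2k$ and all other vertices of degree $2$ (equivalently, $k$ cycles meeting in a single common vertex). The Laplacian spectrum of a graph is the multiset of eigenvalues of $L=D-A$, where $A$ is the adjacency matrix and $D$ the diagonal degree matrix. A graph is determined by its Laplacian spectrum if every graph with the same Laplacian spectrum is isomorphic to it. *)

theory Defs
  imports
    "Jordan_Normal_Form.Char_Poly"
    "Graph_Theory.Graph_Theory"
begin

text \<open>
  Finite simple undirected graphs are the symmetric loop-free finite digraphs without parallel
  arcs of the locale \<^locale>\<open>pair_graph\<close>: an edge between \<open>u\<close> and \<open>v\<close> is represented
  by the two arcs \<open>(u, v)\<close> and \<open>(v, u)\<close>, so the degree of a vertex is its out-degree.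
\<close>

abbreviation vertex_degree :: "'a pair_pre_digraph \<Rightarrow> 'a \<Rightarrow> nat" where
  "vertex_degree G v \<equiv> out_degree (with_proj G) v"

definition rose_graph :: "nat \<Rightarrow> 'a pair_pre_digraph \<Rightarrow> bool" where
  "rose_graph k G \<longleftrightarrow>
     k \<ge> 2 \<and> pair_graph G \<and> Digraph_Component.connected (with_proj G) \<and>
     (\<exists>c \<in> pverts G. vertex_degree G c = 2 * k \<and>
        (\<forall>v \<in> pverts G - {c}. vertex_degree G v = 2))"

text \<open>The matrices below are taken with respect to an enumeration \<open>xs\<close> of the vertices.\<close>

definition adjacency_mat :: "'a pair_pre_digraph \<Rightarrow> 'a list \<Rightarrow> real mat" where
  "adjacency_mat G xs =
     mat (length xs) (length xs) (\<lambda>(i, j). if (xs ! i, xs ! j) \<in> parcs G then 1 else 0)"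

definition degree_mat :: "'a pair_pre_digraph \<Rightarrow> 'a list \<Rightarrow> real mat" where
  "degree_mat G xs =
     mat (length xs) (length xs) (\<lambda>(i, j). if i = j then real (vertex_degree G (xs ! i)) else 0)"

definition laplacian_mat :: "'a pair_pre_digraph \<Rightarrow> 'a list \<Rightarrow> real mat" where
  "laplacian_mat G xs = degree_mat G xs - adjacency_mat G xs"

definition eigenvalue_mset :: "real mat \<Rightarrow> complex multiset" where
  "eigenvalue_mset M = proots (char_poly (map_mat complex_of_real M))"

definition vertex_enum :: "'a pair_pre_digraph \<Rightarrow> 'a list" where
  "vertex_enum G = (SOME xs. distinct xs \<and> set xs = pverts G)"

text \<open>
  The choice of the enumeration is immaterial, see \<open>laplacian_spectrum_eq\<close> below.
\<close>

definition laplacian_spectrum :: "'a pair_pre_digraph \<Rightarrow> complex multiset" where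
  "laplacian_spectrum G = eigenvalue_mset (laplacian_mat G (vertex_enum G))"

text \<open>
  A definition cannot quantify over types, so the vertex type \<open>'b\<close> of the competing graphs is
  a parameter.
\<close>

definition determined_by_laplacian_spectrum :: "'b itself \<Rightarrow> 'a pair_pre_digraph \<Rightarrow> bool" where
  "determined_by_laplacian_spectrum (_ :: 'b itself) G \<longleftrightarrow>
     (\<forall>H :: 'b pair_pre_digraph.
        pair_graph H \<longrightarrow> laplacian_spectrum H = laplacian_spectrum G \<longrightarrow>
        digraph_iso (with_proj G) (with_proj H))"

lemma char_poly_permute:
  fixes A :: "'a :: comm_ring_1 mat"
  assumes A: "A \<in> carrier_mat n n" and p: "p permutes {0..<n}"
  shows "char_poly (mat n n (\<lambda>(i, j). A $$ (p i, p j))) = char_poly A"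
proof -
  have pn: "p i < n" if "i < n" for i
    using permutes_in_image[OF p, of i] that by auto
  have inj: "p i = p j \<longleftrightarrow> i = j" for i j
    using permutes_inj[OF p] by (auto dest: injD)
  let ?C = "char_poly_matrix A"
  have C: "?C \<in> carrier_mat n n" using A by simp
  define R where "R = mat n n (\<lambda>(i, j). ?C $$ (p i, j))"
  have R: "R \<in> carrier_mat n n" by (simp add: R_def)
  define S where "S = mat n n (\<lambda>(i, j). transpose_mat R $$ (p i, j))"
  have S: "S \<in> carrier_mat n n" by (simp add: S_def)
  have eq: "char_poly_matrix (mat n n (\<lambda>(i, j). A $$ (p i, p j))) = transpose_mat S"
    by (rule eq_matI) (use A pn inj in \<open>auto simp: S_def R_def char_poly_matrix_def\<close>)
  have "char_poly (mat n n (\<lambda>(i, j). A $$ (p i, p j))) = det (transpose_mat S)"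
    by (simp add: char_poly_def eq)
  also have "\<dots> = det S" using S by (rule det_transpose)
  also have "\<dots> = signof p * det (transpose_mat R)"
    unfolding S_def by (rule det_permute_rows) (use R p in auto)
  also have "det (transpose_mat R) = det R" using R by (rule det_transpose)
  also have "det R = signof p * det ?C"
    unfolding R_def by (rule det_permute_rows[OF C p])
  also have "signof p * (signof p * det ?C) = det ?C"
    by (simp add: sign_def)
  finally show ?thesis by (simp add: char_poly_def)
qed

lemma laplacian_spectrum_eq:
  assumes "distinct xs" and "set xs = pverts G"
  shows "laplacian_spectrum G = eigenvalue_mset (laplacian_mat G xs)"
proof -
  define ys where "ys = vertex_enum G"
  have "distinct ys \<and> set ys = pverts G"
    unfolding ys_def vertex_enum_def by (rule someI[of _ xs]) (use assms in simp)
  then have "mset ys = mset xs"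
    using assms by (simp add: set_eq_iff_mset_eq_distinct[symmetric])
  then obtain p where p: "p permutes {..<length xs}" and ys: "permute_list p xs = ys"
    by (rule mset_eq_permutation)
  define n where "n = length xs"
  have p': "p permutes {0..<n}" using p by (simp add: n_def lessThan_atLeast0)
  have pn: "p i < n" if "i < n" for i
    using permutes_in_image[OF p', of i] that by auto
  have inj: "p i = p j \<longleftrightarrow> i = j" for i j
    using permutes_inj[OF p] by (auto dest: injD)
  have len: "length ys = n" using ys by (auto simp: n_def)
  have nth: "ys ! i = xs ! p i" if "i < n" for i
    using that p ys by (auto simp: n_def permute_list_nth)
  let ?A = "map_mat complex_of_real (laplacian_mat G xs)"
  have A: "?A \<in> carrier_mat n n"
    by (rule carrier_matI) (simp_all add: laplacian_mat_def degree_mat_def adjacency_mat_def n_def)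
  have "map_mat complex_of_real (laplacian_mat G ys) = mat n n (\<lambda>(i, j). ?A $$ (p i, p j))"
    by (rule eq_matI)
      (auto simp: laplacian_mat_def degree_mat_def adjacency_mat_def len nth pn inj
        n_def[symmetric])
  then show ?thesis
    using char_poly_permute[OF A p']
    by (simp add: laplacian_spectrum_def eigenvalue_mset_def ys_def)
qed

end

theory Submission
  imports Defs "Jordan_Normal_Form.Schur_Decomposition"
begin

text \<open>
  Let \<open>H\<close> have the Laplacian spectrum of a \<open>k\<close>-rose, and put \<open>s = 2 k - 2\<close>. The traces of the first
  three powers of the Laplacian fix \<open>\<Sum> (d - 2) = s\<close> and \<open>\<Sum> (d - 2)\<^sup>2 = s\<^sup>2\<close> over the degrees \<open>d\<close> of \<open>H\<close>,
  and, as a \<open>k\<close>-rose has at most \<open>k\<close> triangles, give \<open>\<Sum> (d - 2)\<^sup>3 \<ge> s\<^sup>3 - 6 k\<close>. For \<open>k \<ge> 3\<close> this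
  forces one vertex of degree \<open>2 k\<close> and degree \<open>2\<close> elsewhere.

  Substituting \<open>x = 2 - z - 1 / z\<close> and eliminating the petals one at a time gives \<open>det (L - x)\<close> of
  a rose in closed form. It has only a simple zero at \<open>x = 0\<close>, so \<open>H\<close> is connected and hence a
  rose; and its expansion at \<open>z = 0\<close> reveals the petal lengths one after the other.
\<close>

subsection \<open>Matrices indexed by a list of vertices\<close>

text \<open>For \<open>0 < z < 1\<close> the value \<open>x = - (1 - z) ^ 2 / z\<close> is negative,
  so it lies below the spectrum and the denominators met in the elimination stay positive. Since
  \<open>2 - x = z + 1 / z\<close>, the equations along a petal become a linear recurrence with
  solutions \<open>z ^ j\<close> and \<open>(1 / z) ^ j\<close>. The two ends of the interval serve
  different purposes: \<open>z\<close> near 1 means \<open>x\<close> near 0 and tests the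
  multiplicity of the eigenvalue 0; \<open>z\<close> near 0 sends \<open>x\<close> to minus infinity
  and exposes the lengths. The degree sequence alone does not make \<open>H\<close> a rose: disjoint
  cycles beside a smaller rose have the same degrees, which is why connectedness needs the
  determinant as well. The triangle count of \<open>H\<close> is not known in advance, but triangles
  lower the trace of the cube of the Laplacian, so extra ones can only raise the sum of cubed
  degrees and a one-sided estimate suffices. The possible deficit \<open>6 k = 3 s + 6\<close> is
  harmless as soon as \<open>s (s - 2) > 6\<close>; this is where \<open>k >= 3\<close>
  enters.\<close>

definition mat_on :: "'a list \<Rightarrow> ('a \<Rightarrow> 'a \<Rightarrow> 'b) \<Rightarrow> 'b mat" where
  "mat_on xs f = mat (length xs) (length xs) (\<lambda>(i, j). f (xs ! i) (xs ! j))"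

lemma mat_on_carrier [simp]: "mat_on xs f \<in> carrier_mat (length xs) (length xs)"
  by (simp add: mat_on_def)

lemma mat_on_append:
  "mat_on (xs @ ys) f = four_block_mat (mat_on xs f)
     (mat (length xs) (length ys) (\<lambda>(i, j). f (xs ! i) (ys ! j)))
     (mat (length ys) (length xs) (\<lambda>(i, j). f (ys ! i) (xs ! j))) (mat_on ys f)"
  by (rule eq_matI) (auto simp: mat_on_def nth_append)

lemma det_mat_on_append:
  fixes f :: "'a \<Rightarrow> 'a \<Rightarrow> 'b :: idom"
  assumes "\<And>u v. u \<in> set xs \<Longrightarrow> v \<in> set ys \<Longrightarrow> f u v = 0"
  shows "det (mat_on (xs @ ys) f) = det (mat_on xs f) * det (mat_on ys f)"
  unfolding mat_on_append
proof (rule det_four_block_mat_upper_right_zero)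
  show "mat (length xs) (length ys) (\<lambda>(i, j). f (xs ! i) (ys ! j)) = 0\<^sub>m (length xs) (length ys)"
    by (rule eq_matI) (use assms in auto)
qed auto

text \<open>The vector \<open>y\<close> solves the linear system of the block \<open>p\<close>, so a column operation clears the
  entries below the block of \<open>c\<close> and \<open>us\<close>.\<close>

lemma det_mat_on_eliminate:
  fixes f :: "'a \<Rightarrow> 'a \<Rightarrow> 'b :: idom" and y :: "nat \<Rightarrow> 'b"
  assumes c: "c \<notin> set us"
    and zero: "\<And>u v. u \<in> set us \<Longrightarrow> v \<in> set p \<Longrightarrow> f u v = 0"
      "\<And>u v. u \<in> set us \<Longrightarrow> v \<in> set p \<Longrightarrow> f v u = 0"
    and solve: "\<And>i. i < length p \<Longrightarrow> (\<Sum>j<length p. f (p ! i) (p ! j) * y j) = f (p ! i) c"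
  defines "g \<equiv> (\<lambda>u v. if u = c \<and> v = c then f c c - (\<Sum>j<length p. f c (p ! j) * y j) else f u v)"
  shows "det (mat_on (c # us @ p) f) = det (mat_on (c # us) g) * det (mat_on p f)"
proof -
  let ?n = "length (c # us)" and ?m = "length p"
  define A where "A = mat_on (c # us) f"
  define B where "B = mat ?n ?m (\<lambda>(i, j). f ((c # us) ! i) (p ! j))"
  define C where "C = mat ?m ?n (\<lambda>(i, j). f (p ! i) ((c # us) ! j))"
  define D where "D = mat_on p f"
  define Y where "Y = mat ?m ?n (\<lambda>(i, j). if j = 0 then - y i else 0)"
  have carr: "A \<in> carrier_mat ?n ?n" "B \<in> carrier_mat ?n ?m" "C \<in> carrier_mat ?m ?n"
    "D \<in> carrier_mat ?m ?m" "Y \<in> carrier_mat ?m ?n"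
    by (auto simp: A_def B_def C_def D_def Y_def mat_on_def)
  have M: "mat_on (c # us @ p) f = four_block_mat A B C D"
    using mat_on_append[of "c # us" p f] by (simp add: A_def B_def C_def D_def)
  \<comment> \<open>Right multiplication by \<open>?N\<close> subtracts from column \<open>c\<close>
    the columns of \<open>p\<close> weighted by \<open>y\<close>.\<close>
  let ?N = "four_block_mat (1\<^sub>m ?n) (0\<^sub>m ?n ?m) Y (1\<^sub>m ?m)"
  have N: "?N \<in> carrier_mat (?n + ?m) (?n + ?m)" using carr by auto
  have detN: "det ?N = 1"
    by (subst det_four_block_mat_upper_right_zero[where n = ?n and m = ?m]) (use carr in auto)
  have prod: "four_block_mat A B C D * ?N
      = four_block_mat (A * 1\<^sub>m ?n + B * Y) (A * 0\<^sub>m ?n ?m + B * 1\<^sub>m ?m)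
          (C * 1\<^sub>m ?n + D * Y) (C * 0\<^sub>m ?n ?m + D * 1\<^sub>m ?m)"
    by (rule mult_four_block_mat[OF carr(1-4) one_carrier_mat zero_carrier_mat carr(5) one_carrier_mat])
  have AB: "A * 1\<^sub>m ?n + B * Y = mat_on (c # us) g"
  proof (rule eq_matI)
    fix i j assume "i < dim_row (mat_on (c # us) g)" "j < dim_col (mat_on (c # us) g)"
    then have ij: "i < ?n" "j < ?n" by (auto simp: mat_on_def)
    have "(B * Y) $$ (i, j) = (\<Sum>l<?m. f ((c # us) ! i) (p ! l) * (if j = 0 then - y l else 0))"
      using ij by (auto simp: B_def Y_def scalar_prod_def lessThan_atLeast0 intro!: sum.cong)
    moreover have "(A * 1\<^sub>m ?n) $$ (i, j) = f ((c # us) ! i) ((c # us) ! j)"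
      using ij carr by (simp add: A_def mat_on_def)
    \<comment> \<open>The rows of \<open>us\<close> vanish on \<open>p\<close>, so in the upper left
      block only the entry at \<open>(c, c)\<close> changes.\<close>
    moreover have "f ((c # us) ! i) (p ! l) = 0" if "i \<noteq> 0" "l < ?m" for l
      using that ij zero by (cases i) auto
    moreover have "(c # us) ! i = c \<longleftrightarrow> i = 0" if "i < ?n" for i
      using c that by (cases i) auto
    moreover have "us ! (i - Suc 0) \<noteq> c" if "0 < i" "i < ?n" for i
      using c that by auto
    ultimately show "(A * 1\<^sub>m ?n + B * Y) $$ (i, j) = mat_on (c # us) g $$ (i, j)"
      using ij carr by (cases "i = 0"; cases "j = 0") (auto simp: mat_on_def g_def sum_negf)
  qed (use carr in \<open>auto simp: mat_on_def\<close>)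
  have CD: "C * 1\<^sub>m ?n + D * Y = 0\<^sub>m ?m ?n"
  proof (rule eq_matI)
    fix i j assume "i < dim_row (0\<^sub>m ?m ?n :: 'b mat)" "j < dim_col (0\<^sub>m ?m ?n :: 'b mat)"
    then have ij: "i < ?m" "j < ?n" by auto
    have "(D * Y) $$ (i, j) = (\<Sum>l<?m. f (p ! i) (p ! l) * (if j = 0 then - y l else 0))"
      using ij by (auto simp: D_def Y_def mat_on_def scalar_prod_def lessThan_atLeast0 intro!: sum.cong)
    moreover have "(C * 1\<^sub>m ?n) $$ (i, j) = f (p ! i) ((c # us) ! j)"
      using ij carr by (simp add: C_def)
    moreover have "f (p ! i) ((c # us) ! j) = 0" if "j \<noteq> 0"
      using that ij zero by (cases j) auto
    ultimately show "(C * 1\<^sub>m ?n + D * Y) $$ (i, j) = 0\<^sub>m ?m ?n $$ (i, j)"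
      using ij carr solve[OF ij(1)] by (cases "j = 0") (auto simp: sum_negf)
  qed (use carr in auto)
  have "det (mat_on (c # us @ p) f) = det (four_block_mat A B C D * ?N)"
    by (subst det_mult[OF _ N]) (use carr detN M in auto)
  also have "\<dots> = det (mat_on (c # us) g) * det D"
    unfolding prod AB CD
    by (subst det_four_block_mat_lower_left_zero[where n = ?n and m = ?m])
      (use carr in \<open>auto simp: mat_on_def\<close>)
  finally show ?thesis by (simp add: D_def)
qed

subsection \<open>The determinant of a rose\<close>

text \<open>With \<open>w = z + 1 / z = 2 - x\<close> this is the block of \<open>L - x\<close> on
  the inner vertices of a petal, all of degree 2.\<close>

definition tridiag :: "real \<Rightarrow> nat \<Rightarrow> nat \<Rightarrow> real" where
  "tridiag w i j = (if i = j then w else if j = Suc i \<or> i = Suc j then -1 else 0)"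

text \<open>The vector occupies the positions 1 to \<open>m\<close>; \<open>Y 0\<close> and
  \<open>Y (Suc m)\<close> are boundary values outside it. For a solution of the recurrence only the
  two boundary terms survive, so choosing these values solves every system whose right-hand side
  lives at the ends of the path.\<close>

lemma sum_tridiag:
  assumes "i < m"
  shows "(\<Sum>j<m. tridiag w i j * Y (Suc j)) = w * Y (Suc i) - Y i - Y (i + 2)
    + (if i = 0 then Y 0 else 0) + (if Suc i = m then Y (Suc m) else 0)"
proof -
  have "(\<Sum>j<m. tridiag w i j * Y (Suc j))
      = (\<Sum>j<m. (if j = i then w * Y (Suc i) else 0) - (if j = i - 1 then if i = 0 then 0 else Y i else 0)
          - (if j = Suc i then Y (i + 2) else 0))"
    by (rule sum.cong) (auto simp: tridiag_def)
  also have "\<dots> = w * Y (Suc i) - (if i = 0 then 0 else Y i) - (if Suc i < m then Y (i + 2) else 0)"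
    using assms by (simp add: sum_subtractf sum.delta del: sum.delta')
  finally show ?thesis using assms by (cases "m = Suc i") auto
qed

text \<open>Up to normalisation this is \<open>sinh (n t)\<close> for \<open>z = exp (- t)\<close>.\<close>

definition qsinh :: "real \<Rightarrow> nat \<Rightarrow> real" where
  "qsinh z n = (1 / z) ^ n - z ^ n"

lemma qsinh_rec: "z \<noteq> 0 \<Longrightarrow> qsinh z (n + 2) = (z + 1 / z) * qsinh z (Suc n) - qsinh z n"
  by (simp add: qsinh_def field_simps)

lemma qsinh_pos:
  assumes "0 < z" "z < 1" "0 < n" shows "0 < qsinh z n"
proof -
  have "z ^ n < 1" using assms by (simp add: power_Suc_less_one power_less_one_iff)
  moreover have "1 < (1 / z) ^ n" using assms by (intro one_less_power) auto
  ultimately show ?thesis by (simp add: qsinh_def)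
qed

text \<open>The Chebyshev value \<open>sinh ((m + 1) t) / sinh t\<close> at
  \<open>w = 2 cosh t\<close>. In the induction the first vertex plays the centre, with nothing
  besides it, and the rest of the path is eliminated.\<close>

lemma det_path:
  fixes f :: "'a \<Rightarrow> 'a \<Rightarrow> real"
  assumes z: "0 < z" "z < 1"
    and f: "\<And>i j. i < length p \<Longrightarrow> j < length p \<Longrightarrow> f (p ! i) (p ! j) = tridiag (z + 1 / z) i j"
  shows "det (mat_on p f) = qsinh z (Suc (length p)) / qsinh z 1"
  using f
proof (induction p)
  case Nil
  have "qsinh z (Suc 0) \<noteq> 0" using qsinh_pos[OF z, of "Suc 0"] by simp
  then show ?case by (simp add: mat_on_def)
next
  case (Cons v q)
  let ?m = "length q"
  have fq: "f (q ! i) (q ! j) = tridiag (z + 1 / z) i j" if "i < ?m" "j < ?m" for i j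
    using Cons.prems[of "Suc i" "Suc j"] that by (simp add: tridiag_def)
  have fv: "f v (q ! j) = tridiag (z + 1 / z) 0 (Suc j)" "f (q ! j) v = tridiag (z + 1 / z) (Suc j) 0"
    if "j < ?m" for j
    using Cons.prems[of 0 "Suc j"] Cons.prems[of "Suc j" 0] that by simp_all
  have s: "qsinh z (Suc ?m) > 0" using qsinh_pos[OF z] by simp
  \<comment> \<open>The boundary values are -1 next to \<open>v\<close> and 0 at the far end,
    because only the first vertex of \<open>q\<close> is adjacent to \<open>v\<close>.\<close>
  define Y where "Y j = - qsinh z (Suc ?m - j) / qsinh z (Suc ?m)" for j
  have Y0: "Y 0 = -1" using s by (simp add: Y_def)
  have Y1: "Y (Suc ?m) = 0" by (simp add: Y_def qsinh_def)
  have Yrec: "Y (i + 2) = (z + 1 / z) * Y (Suc i) - Y i" if i: "i < ?m" for i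
  proof -
    obtain d where d: "?m = Suc (i + d)" using less_imp_Suc_add[OF i] by auto
    then have "Suc ?m - i = d + 2" "Suc ?m - Suc i = Suc d" "Suc ?m - (i + 2) = d" by auto
    then show ?thesis
      using qsinh_rec[of z d] z s by (simp add: Y_def divide_simps del: One_nat_def)
  qed
  have det: "det (mat_on (v # [] @ q) f) = det (mat_on [v] (\<lambda>u w. if u = v \<and> w = v
      then f v v - (\<Sum>j<?m. f v (q ! j) * Y (Suc j)) else f u w)) * det (mat_on q f)"
  proof (rule det_mat_on_eliminate)
    fix i assume i: "i < ?m"
    have "(\<Sum>j<?m. f (q ! i) (q ! j) * Y (Suc j)) = (\<Sum>j<?m. tridiag (z + 1 / z) i j * Y (Suc j))"
      using i by (intro sum.cong) (auto simp: fq)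
    also have "\<dots> = f (q ! i) v"
      using i by (simp add: sum_tridiag Yrec[OF i, simplified] Y0 Y1 fv) (auto simp: tridiag_def)
    finally show "(\<Sum>j<?m. f (q ! i) (q ! j) * Y (Suc j)) = f (q ! i) v" .
  qed auto
  have "(\<Sum>j<?m. f v (q ! j) * Y (Suc j)) = (\<Sum>j<?m. if j = 0 then - Y 1 else 0)"
    by (intro sum.cong) (auto simp: fv tridiag_def)
  also have "\<dots> = - Y 1"
    using Y1 by (cases ?m) (simp_all add: sum.delta)
  finally have sum: "(\<Sum>j<?m. f v (q ! j) * Y (Suc j)) = - Y 1" .
  have "f v v = z + 1 / z" using Cons.prems[of 0 0] by (simp add: tridiag_def)
  then have "det (mat_on (v # q) f) = (z + 1 / z + Y 1) * det (mat_on q f)"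
    using det sum by (simp add: mat_on_def det_single)
  also have "\<dots> = (z + 1 / z + Y 1) * (qsinh z (Suc ?m) / qsinh z 1)"
    using Cons.IH fq by simp
  also have "(z + 1 / z + Y 1) * (qsinh z (Suc ?m) / qsinh z 1) = qsinh z (?m + 2) / qsinh z 1"
    using qsinh_rec[of z ?m] s z by (simp add: Y_def distrib_right left_diff_distrib)
  also have "?m + 2 = Suc (length (v # q))" by simp
  finally show ?case .
qed

text \<open>The amount by which eliminating a petal with \<open>m\<close> vertices lowers the
  diagonal entry of the centre (a Schur complement).\<close>

definition petal_weight :: "real \<Rightarrow> nat \<Rightarrow> real" where
  "petal_weight z m = 2 * (z + z ^ m) / (1 + z ^ Suc m)"

lemma det_attach_petal:
  fixes f :: "'a \<Rightarrow> 'a \<Rightarrow> real"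
  assumes z: "0 < z" "z < 1" and c: "c \<notin> set us" and m: "2 \<le> length p"
    and zero: "\<And>u v. u \<in> set us \<Longrightarrow> v \<in> set p \<Longrightarrow> f u v = 0"
      "\<And>u v. u \<in> set us \<Longrightarrow> v \<in> set p \<Longrightarrow> f v u = 0"
    and f: "\<And>i j. i < length p \<Longrightarrow> j < length p \<Longrightarrow> f (p ! i) (p ! j) = tridiag (z + 1 / z) i j"
    and fc: "\<And>i. i < length p \<Longrightarrow> f (p ! i) c = (if i = 0 \<or> Suc i = length p then -1 else 0)"
      "\<And>i. i < length p \<Longrightarrow> f c (p ! i) = (if i = 0 \<or> Suc i = length p then -1 else 0)"
  shows "det (mat_on (c # us @ p) f)
    = det (mat_on (c # us) (\<lambda>u v. if u = c \<and> v = c then f c c - petal_weight z (length p) else f u v))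
      * (qsinh z (Suc (length p)) / qsinh z 1)"
proof -
  let ?m = "length p"
  \<comment> \<open>The symmetric solution, with boundary value -1 at both ends, since both end
    vertices of the petal are adjacent to \<open>c\<close>. They are distinct because
    \<open>2 <= length p\<close>.\<close>
  define Y where "Y j = - (z ^ j + z ^ (Suc ?m - j)) / (1 + z ^ Suc ?m)" for j
  have pos: "1 + z ^ Suc ?m > 0" using z by (intro add_pos_pos) auto
  have Y0: "Y 0 = -1" and Y1: "Y (Suc ?m) = -1"
    using pos by (simp_all add: Y_def field_simps)
  have Yrec: "Y (i + 2) = (z + 1 / z) * Y (Suc i) - Y i" if i: "i < ?m" for i
  proof -
    obtain d where d: "?m = Suc (i + d)" using less_imp_Suc_add[OF i] by auto
    then have e: "Suc ?m - i = d + 2" "Suc ?m - Suc i = Suc d" "Suc ?m - (i + 2) = d" by auto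
    have "z ^ (i + 2) + z ^ d = (z + 1 / z) * (z ^ Suc i + z ^ Suc d) - (z ^ i + z ^ (d + 2))"
      using z by (simp add: field_simps power2_eq_square)
    moreover have "- a / K = w * (- b / K) - - d / K" if "a = w * b - d" for a b d w K :: real
      using that by (simp add: diff_divide_distrib)
    ultimately show ?thesis unfolding Y_def e by blast
  qed
  have det: "det (mat_on (c # us @ p) f) = det (mat_on (c # us) (\<lambda>u w. if u = c \<and> w = c
      then f c c - (\<Sum>j<?m. f c (p ! j) * Y (Suc j)) else f u w)) * det (mat_on p f)"
  proof (rule det_mat_on_eliminate)
    fix i assume i: "i < ?m"
    have "(\<Sum>j<?m. f (p ! i) (p ! j) * Y (Suc j)) = (\<Sum>j<?m. tridiag (z + 1 / z) i j * Y (Suc j))"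
      using i by (intro sum.cong) (auto simp: f)
    also have "\<dots> = f (p ! i) c"
      using i m by (simp add: sum_tridiag Yrec[OF i, simplified] Y0 Y1 fc)
    finally show "(\<Sum>j<?m. f (p ! i) (p ! j) * Y (Suc j)) = f (p ! i) c" .
  qed (use c zero in auto)
  have "(\<Sum>j<?m. f c (p ! j) * Y (Suc j))
      = (\<Sum>j<?m. (if j = 0 then - Y 1 else 0) + (if j = ?m - 1 then - Y ?m else 0))"
    using m by (intro sum.cong) (auto simp: fc)
  also have "\<dots> = - Y 1 - Y ?m"
    using m by (auto simp: sum.distrib)
  also have "\<dots> = petal_weight z ?m"
    using m by (simp add: Y_def petal_weight_def add_divide_distrib diff_divide_distrib)
  finally have sum: "(\<Sum>j<?m. f c (p ! j) * Y (Suc j)) = petal_weight z ?m" .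
  have path: "det (mat_on p f) = qsinh z (Suc ?m) / qsinh z 1"
    by (rule det_path[OF z f])
  show ?thesis using det unfolding sum path .
qed

text \<open>Each elimination alters the entry at \<open>c\<close>, so the induction must allow
  arbitrary \<open>f\<close>; it runs from the back of the list, where
  \<open>det_attach_petal\<close> expects the block to be removed.\<close>

lemma det_rose:
  fixes f :: "'a \<Rightarrow> 'a \<Rightarrow> real"
  assumes z: "0 < z" "z < 1" and "distinct (c # concat pss)"
    and "\<And>p. p \<in> set pss \<Longrightarrow> 2 \<le> length p"
    and "\<And>p u v. p \<in> set pss \<Longrightarrow> u \<in> set (concat pss) - set p \<Longrightarrow> v \<in> set p \<Longrightarrow> f u v = 0 \<and> f v u = 0"
    and "\<And>p i j. p \<in> set pss \<Longrightarrow> i < length p \<Longrightarrow> j < length p \<Longrightarrow>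
      f (p ! i) (p ! j) = tridiag (z + 1 / z) i j"
    and "\<And>p i. p \<in> set pss \<Longrightarrow> i < length p \<Longrightarrow>
      f (p ! i) c = (if i = 0 \<or> Suc i = length p then -1 else 0) \<and>
      f c (p ! i) = (if i = 0 \<or> Suc i = length p then -1 else 0)"
  shows "det (mat_on (c # concat pss) f) = (\<Prod>m\<leftarrow>map length pss. qsinh z (Suc m) / qsinh z 1)
    * (f c c - (\<Sum>m\<leftarrow>map length pss. petal_weight z m))"
  using assms(3-)
proof (induction pss arbitrary: f rule: rev_induct)
  case Nil
  then show ?case by (simp add: mat_on_def det_single)
next
  case (snoc p pss)
  let ?g = "\<lambda>u v. if u = c \<and> v = c then f c c - petal_weight z (length p) else f u v"
  have d: "distinct (c # concat pss)" "c \<notin> set p" "set p \<inter> set (concat pss) = {}"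
    using snoc.prems(1) by auto
  have cn: "q ! i \<noteq> c" if "q \<in> set pss" "i < length q" for q i
    using d(1) that nth_mem by fastforce
  have "det (mat_on (c # concat (pss @ [p])) f) = det (mat_on (c # concat pss @ p) f)"
    by simp
  also have "\<dots> = det (mat_on (c # concat pss) ?g) * (qsinh z (Suc (length p)) / qsinh z 1)"
  proof (rule det_attach_petal[OF z])
    show "2 \<le> length p" using snoc.prems(2) by simp
    show "f u v = 0" "f v u = 0" if "u \<in> set (concat pss)" "v \<in> set p" for u v
      using snoc.prems(3)[of p u v] that d by auto
  qed (use snoc.prems(4,5) d in auto)
  also have "det (mat_on (c # concat pss) ?g) = (\<Prod>m\<leftarrow>map length pss. qsinh z (Suc m) / qsinh z 1)
    * (?g c c - (\<Sum>m\<leftarrow>map length pss. petal_weight z m))"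
  proof (rule snoc.IH[OF d(1)])
    show "?g u v = 0 \<and> ?g v u = 0" if "q \<in> set pss" "u \<in> set (concat pss) - set q" "v \<in> set q" for q u v
    proof -
      have "v \<noteq> c" using that d by auto
      then show ?thesis using snoc.prems(3)[of q u v] that by auto
    qed
  qed (use snoc.prems cn in auto)
  finally show ?case by (simp add: diff_diff_eq add.commute mult.commute mult.left_commute)
qed

subsection \<open>Decomposition into petals\<close>

locale simple_graph =
  fixes V :: "'a set" and E :: "('a \<times> 'a) set"
  assumes fin: "finite V" and arcs: "E \<subseteq> V \<times> V" and sym: "sym E" and irrefl: "irrefl E"
begin

abbreviation nbrs :: "'a \<Rightarrow> 'a set" where "nbrs v \<equiv> E `` {v}"

abbreviation deg :: "'a \<Rightarrow> nat" where "deg v \<equiv> card (nbrs v)"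

text \<open>Phrased by closed sets because both uses need this form: the union of the petals is
  closed, and a proper closed set splits the Laplacian into blocks.\<close>

definition conn :: bool where
  "conn \<longleftrightarrow> (\<forall>S. S \<subseteq> V \<longrightarrow> S \<noteq> {} \<longrightarrow> E `` S \<subseteq> S \<longrightarrow> S = V)"

lemma nbrs_sub: "nbrs v \<subseteq> V" and fin_nbrs: "finite (nbrs v)"
  using arcs fin by (auto intro: finite_subset)

lemma nbrs_commute: "u \<in> nbrs v \<longleftrightarrow> v \<in> nbrs u"
  using sym by (auto dest: symD)

lemma not_self: "v \<notin> nbrs v"
  using irrefl by (auto simp: irrefl_def)

text \<open>The list runs through a cycle at \<open>c\<close> with \<open>c\<close> left out, so the
  cycle has \<open>length p + 1\<close> vertices. In the padded list \<open>p ! i\<close> sits at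
  position \<open>i + 1\<close>, between its two neighbours.\<close>

definition petal :: "'a \<Rightarrow> 'a list \<Rightarrow> bool" where
  "petal c p \<longleftrightarrow> 2 \<le> length p \<and> distinct (c # p) \<and> set p \<subseteq> V \<and>
     (\<forall>i<length p. nbrs (p ! i) = {(c # p @ [c]) ! i, (c # p @ [c]) ! (i + 2)})"

definition petals :: "'a \<Rightarrow> 'a list list \<Rightarrow> bool" where
  "petals c pss \<longleftrightarrow> distinct (c # concat pss) \<and> (\<forall>p \<in> set pss. petal c p)"

lemma petal_nbrs_sub:
  assumes "petal c p" "v \<in> set p" shows "nbrs v \<subseteq> insert c (set p)"
proof -
  obtain i where i: "i < length p" "v = p ! i" using assms(2) by (metis in_set_conv_nth)
  have *: "(c # p @ [c]) ! j \<in> insert c (set p)" if "j < length p + 2" for j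
    using nth_mem[of j "c # p @ [c]"] that by auto
  have "nbrs v = {(c # p @ [c]) ! i, (c # p @ [c]) ! (i + 2)}"
    using assms(1) i by (auto simp: petal_def)
  moreover have "(c # p @ [c]) ! i \<in> insert c (set p)" by (rule *) (use i in simp)
  moreover have "(c # p @ [c]) ! (i + 2) \<in> insert c (set p)" by (rule *) (use i in simp)
  ultimately show ?thesis by (simp only: insert_subset empty_subsetI simp_thms)
qed

text \<open>A longest path from \<open>u\<close> avoiding \<open>c\<close> closes up at
  \<open>c\<close>: its last vertex has a second neighbour, which by maximality is not new, and
  every earlier vertex of the path already has both its neighbours accounted for.\<close>

lemma ex_petal:
  assumes c: "c \<in> V" and two: "\<And>v. v \<in> V - {c} \<Longrightarrow> deg v = 2" and u: "u \<in> nbrs c"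
  shows "\<exists>p. petal c p \<and> p ! 0 = u"
proof -
  define path where "path p \<longleftrightarrow> p \<noteq> [] \<and> p ! 0 = u \<and> distinct (c # p) \<and>
    (\<forall>i. Suc i < length p \<longrightarrow> p ! Suc i \<in> nbrs (p ! i))" for p
  have "path [u]" using u not_self by (auto simp: path_def)
  have sub: "set p \<subseteq> V" if "path p" for p
  proof
    fix v assume "v \<in> set p"
    then obtain i where "i < length p" "v = p ! i" by (metis in_set_conv_nth)
    then show "v \<in> V" using that u arcs by (cases i) (auto simp: path_def)
  qed
  have bound: "length p \<le> card V" if "path p" for p
    using card_mono[OF fin sub[OF that]] that distinct_card[of p] by (simp add: path_def)
  have "\<exists>p. path p \<and> (\<forall>q. path q \<longrightarrow> length q \<le> length p)"
    using \<open>path [u]\<close> by (rule ex_has_greatest_nat[where f = length and b = "Suc (card V)"])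
      (use bound in \<open>auto simp: less_Suc_eq_le\<close>)
  then obtain p where p: "path p" and max: "\<And>q. path q \<Longrightarrow> length q \<le> length p"
    by blast
  let ?m = "length p"
  have m: "0 < ?m" using p by (auto simp: path_def)
  have d: "distinct (c # p)" using p by (auto simp: path_def)
  have neq: "(c # p) ! i \<noteq> (c # p) ! j" if "i \<le> ?m" "j \<le> ?m" "i \<noteq> j" for i j
    using d that by (subst nth_eq_iff_index_eq) auto
  \<comment> \<open>In \<open>c # p\<close> indices are shifted by one, so
    \<open>(c # p) ! i\<close> is the predecessor of \<open>p ! i\<close>, with \<open>c\<close>
    preceding \<open>u\<close>.\<close>
  have prev: "(c # p) ! i \<in> nbrs (p ! i)" if "i < ?m" for i
    using p u that nbrs_commute by (cases i) (auto simp: path_def)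
  have mid: "nbrs (p ! i) = {(c # p) ! i, p ! Suc i}" if i: "Suc i < ?m" for i
  proof -
    have "p ! i \<in> V - {c}" using sub[OF p] d i nth_mem[of i p] by auto
    then have "card (nbrs (p ! i)) = 2" using two by blast
    moreover have "{(c # p) ! i, p ! Suc i} \<subseteq> nbrs (p ! i)"
      using prev[of i] i p by (auto simp: path_def)
    moreover have "(c # p) ! i \<noteq> p ! Suc i" using neq[of i "Suc (Suc i)"] i by simp
    ultimately show ?thesis by (metis card_2_iff card_subset_eq fin_nbrs)
  qed
  let ?w = "p ! (?m - 1)"
  have w: "?w \<in> V - {c}" using sub[OF p] d m nth_mem[of "?m - 1" p] by auto
  have other: "\<exists>y. A = {x, y} \<and> y \<noteq> x" if "card A = 2" "x \<in> A" for A and x :: 'a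
    using that by (auto simp: card_2_iff doubleton_eq_iff)
  obtain x where x: "nbrs ?w = {(c # p) ! (?m - 1), x}" "x \<noteq> (c # p) ! (?m - 1)"
    using other[of "nbrs ?w" "(c # p) ! (?m - 1)"] two[OF w] prev[of "?m - 1"] m by auto
  have "x = c"
  proof (rule ccontr)
    assume "x \<noteq> c"
    have "x \<in> set p"
    proof (rule ccontr)
      assume "x \<notin> set p"
      have "(p @ [x]) ! Suc i \<in> nbrs ((p @ [x]) ! i)" if "Suc i < length (p @ [x])" for i
      proof (cases "Suc i < ?m")
        case True
        then show ?thesis using p by (simp add: path_def nth_append)
      next
        case False
        then have "i = ?m - 1" "Suc i = ?m" using that by auto
        then show ?thesis using x(1) by (simp add: nth_append)
      qed
      then have "path (p @ [x])"
        using p \<open>x \<notin> set p\<close> \<open>x \<noteq> c\<close> m unfolding path_def by (auto simp: nth_append)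
      then show False using max[of "p @ [x]"] by simp
    qed
    then obtain j where j: "j < ?m" "x = p ! j" by (metis in_set_conv_nth)
    have "?w \<in> nbrs x" using x nbrs_commute by auto
    have "j \<noteq> ?m - 1" using \<open>?w \<in> nbrs x\<close> j not_self by auto
    then have j': "Suc j < ?m" using j by auto
    then have "?w = (c # p) ! j \<or> ?w = (c # p) ! Suc (Suc j)"
      using mid \<open>?w \<in> nbrs x\<close> j by auto
    moreover have "?w = (c # p) ! ?m" using m by (cases ?m) auto
    ultimately have "Suc (Suc j) = ?m"
      using neq[of ?m j] neq[of ?m "Suc (Suc j)"] j' by force
    then have "x = (c # p) ! (?m - 1)" using j by (metis diff_Suc_1 nth_Cons_Suc)
    then show False using x by simp
  qed
  \<comment> \<open>On a path with one vertex the predecessor is \<open>c\<close> itself, so the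
    second neighbour \<open>x\<close> could not be \<open>c\<close> again.\<close>
  then have "?m \<noteq> 1" using x by auto
  then have m2: "2 \<le> ?m" using m by linarith
  have "nbrs (p ! i) = {(c # p @ [c]) ! i, (c # p @ [c]) ! (i + 2)}" if i: "i < ?m" for i
  proof (cases "Suc i < ?m")
    case True
    then show ?thesis using mid[OF True] by (auto simp: nth_Cons nth_append split: nat.splits)
  next
    case False
    then have "i = ?m - 1" using i by simp
    then show ?thesis using x \<open>x = c\<close> m2 by (auto simp: nth_Cons nth_append split: nat.splits)
  qed
  then have "petal c p" using m2 d sub[OF p] by (auto simp: petal_def)
  then show ?thesis using p by (auto simp: path_def)
qed

text \<open>Membership in \<open>q\<close> propagates backwards along \<open>p\<close>: a neighbour
  of a vertex of \<open>q\<close> is \<open>c\<close> or again in \<open>q\<close>. A common vertex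
  would thus force \<open>p ! 0\<close> into \<open>q\<close>.\<close>

lemma petals_disjoint:
  assumes p: "petal c p" and q: "petal c q" and "p ! 0 \<notin> set q"
  shows "set p \<inter> set q = {}"
proof -
  have "i < length p \<Longrightarrow> p ! i \<notin> set q" for i
  proof (induction i)
    case (Suc i)
    show ?case
    proof
      assume "p ! Suc i \<in> set q"
      moreover have "p ! i \<in> nbrs (p ! Suc i)"
        using p Suc.prems by (auto simp: petal_def nth_append)
      ultimately have "p ! i \<in> insert c (set q)" using petal_nbrs_sub[OF q] by blast
      moreover have "p ! i \<noteq> c" using p Suc.prems nth_mem[of i p] by (auto simp: petal_def)
      ultimately show False using Suc by auto
    qed
  qed (use assms in simp)
  then show ?thesis by (metis disjoint_iff in_set_conv_nth)
qed

text \<open>A disjoint family of petals of maximal total length contains all neighbours of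
  \<open>c\<close>, since a missing one would start a further petal. Together with \<open>c\<close>
  it is then closed, hence everything.\<close>

lemma ex_petals:
  assumes conn: conn and c: "c \<in> V" and two: "\<And>v. v \<in> V - {c} \<Longrightarrow> deg v = 2"
  shows "\<exists>pss. petals c pss \<and> set (c # concat pss) = V"
proof -
  have sub: "set (concat pss) \<subseteq> V" if "petals c pss" for pss
    using that by (auto simp: petals_def petal_def)
  have bound: "length (concat pss) \<le> card V" if "petals c pss" for pss
    using card_mono[OF fin sub[OF that]] that distinct_card[of "concat pss"] by (simp add: petals_def)
  have "petals c []" by (simp add: petals_def)
  then have "\<exists>pss. petals c pss \<and> (\<forall>qss. petals c qss \<longrightarrow> length (concat qss) \<le> length (concat pss))"
    by (rule ex_has_greatest_nat[where f = "\<lambda>pss. length (concat pss)" and b = "Suc (card V)"])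
      (use bound in \<open>auto simp: less_Suc_eq_le\<close>)
  then obtain pss where pss: "petals c pss"
    and max: "\<And>qss. petals c qss \<Longrightarrow> length (concat qss) \<le> length (concat pss)"
    by blast
  have Nc: "nbrs c \<subseteq> set (concat pss)"
  proof
    fix u assume u: "u \<in> nbrs c"
    show "u \<in> set (concat pss)"
    proof (rule ccontr)
      assume nu: "u \<notin> set (concat pss)"
      obtain p where p: "petal c p" "p ! 0 = u" using ex_petal[OF c two u] by blast
      have "set p \<inter> set q = {}" if "q \<in> set pss" for q
        using petals_disjoint[OF p(1), of q] pss that nu p(2) by (auto simp: petals_def)
      then have "petals c (p # pss)" using p pss by (auto simp: petals_def petal_def)
      then have "length p = 0" using max[of "p # pss"] by simp
      then show False using p by (simp add: petal_def)
    qed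
  qed
  have "set (c # concat pss) = V"
  proof (rule conn[unfolded conn_def, rule_format])
    show "set (c # concat pss) \<subseteq> V" using sub[OF pss] c by simp
    have "nbrs v \<subseteq> set (c # concat pss)" if "v \<in> set (concat pss)" for v
      using that pss petal_nbrs_sub by (fastforce simp: petals_def)
    then show "E `` set (c # concat pss) \<subseteq> set (c # concat pss)" using Nc by auto
  qed simp
  then show ?thesis using pss by blast
qed

lemma petal_adj_center:
  assumes "petal c p" "i < length p"
  shows "c \<in> nbrs (p ! i) \<longleftrightarrow> i = 0 \<or> Suc i = length p"
proof -
  have "p ! j \<noteq> c" if "j < length p" for j using assms(1) that nth_mem[of j p] by (auto simp: petal_def)
  then show ?thesis using assms
    by (auto simp: petal_def nth_Cons nth_append split: nat.splits)
qed

lemma petal_adj: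
  assumes "petal c p" "i < length p" "j < length p"
  shows "p ! j \<in> nbrs (p ! i) \<longleftrightarrow> j = Suc i \<or> i = Suc j"
proof -
  have "p ! l \<noteq> c" if "l < length p" for l using assms(1) that nth_mem[of l p] by (auto simp: petal_def)
  moreover have "p ! l = p ! l' \<longleftrightarrow> l = l'" if "l < length p" "l' < length p" for l l'
    using assms(1) that by (auto simp: petal_def nth_eq_iff_index_eq)
  ultimately show ?thesis using assms
    by (auto simp: petal_def nth_Cons nth_append split: nat.splits if_splits)
qed

lemma deg_center:
  assumes "petals c pss" and V: "set (c # concat pss) = V"
  shows "deg c = 2 * length pss"
proof -
  have p: "petal c p" if "p \<in> set pss" for p using assms that by (auto simp: petals_def)
  have inner: "nbrs c \<inter> set p = {p ! 0, p ! (length p - 1)}" if "p \<in> set pss" for p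
  proof -
    have "v \<in> nbrs c \<inter> set p \<longleftrightarrow> v \<in> {p ! 0, p ! (length p - 1)}" for v
    proof -
      have "v \<in> nbrs c \<inter> set p \<longleftrightarrow> (\<exists>i<length p. v = p ! i \<and> c \<in> nbrs (p ! i))"
        using nbrs_commute by (auto simp: in_set_conv_nth)
      also have "\<dots> \<longleftrightarrow> (\<exists>i<length p. v = p ! i \<and> (i = 0 \<or> i = length p - 1))"
      proof -
        have "c \<in> nbrs (p ! i) \<longleftrightarrow> i = 0 \<or> i = length p - 1" if "i < length p" for i
          using petal_adj_center[OF p[OF \<open>p \<in> set pss\<close>] that] that by auto
        then show ?thesis by blast
      qed
      also have "\<dots> \<longleftrightarrow> v \<in> {p ! 0, p ! (length p - 1)}"
      proof -
        have "0 < length p" "length p - 1 < length p" using p[OF that] by (auto simp: petal_def)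
        then show ?thesis by blast
      qed
      finally show ?thesis .
    qed
    then show ?thesis by blast
  qed
  have two: "card (nbrs c \<inter> set p) = 2" if "p \<in> set pss" for p
  proof -
    have "p ! 0 \<noteq> p ! (length p - 1)"
      using p[OF that] nth_eq_iff_index_eq[of p 0 "length p - 1"] by (cases "p = []") (auto simp: petal_def)
    then show ?thesis unfolding inner[OF that] by simp
  qed
  \<comment> \<open>As no petal is empty, distinctness of the concatenation makes the petals
    themselves distinct, so sums over the list and over its set agree.\<close>
  have dist: "distinct (concat pss)" "[] \<notin> set pss" using assms p by (auto simp: petals_def petal_def)
  then have dist': "distinct pss" and disj: "\<And>p q. p \<in> set pss \<Longrightarrow> q \<in> set pss \<Longrightarrow> p \<noteq> q \<Longrightarrow> set p \<inter> set q = {}"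
    by (auto simp: distinct_concat_iff removeAll_id)
  have "nbrs c = (\<Union>p\<in>set pss. nbrs c \<inter> set p)"
    using V nbrs_sub[of c] not_self[of c] by auto
  then have "deg c = card (\<Union>p\<in>set pss. nbrs c \<inter> set p)" by simp
  also have "\<dots> = (\<Sum>p\<in>set pss. card (nbrs c \<inter> set p))"
    using disj by (intro card_UN_disjoint) (auto simp: fin_nbrs)
  also have "\<dots> = 2 * length pss" using two by (simp add: distinct_card[OF dist'])
  finally show ?thesis .
qed

end

subsection \<open>The petal lengths are determined\<close>

lemma tendsto_power_quotient:
  assumes "(l :: nat) < m"
  shows "((\<lambda>z :: real. z ^ m / z ^ l) \<longlongrightarrow> 0) (at_right 0)"
proof -
  have "((\<lambda>z :: real. z ^ (m - l)) \<longlongrightarrow> 0 ^ (m - l)) (at_right 0)"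
    by (intro tendsto_intros)
  moreover have "eventually (\<lambda>z :: real. z ^ (m - l) = z ^ m / z ^ l) (at_right 0)"
    using assms by (auto simp: eventually_at_right_field power_diff intro!: exI[of _ 1])
  ultimately show ?thesis using assms by (simp add: tendsto_cong zero_power)
qed

text \<open>The product is \<open>1 + o(z ^ l)\<close>. Both limits go through one induction because
  the step for the second uses the first.\<close>

lemma tendsto_prod_mset_power:
  assumes "\<forall>c\<in>#A. l < (c :: nat)"
  shows "((\<lambda>z :: real. (\<Prod>c\<in>#A. 1 - z ^ c)) \<longlongrightarrow> 1) (at_right 0)"
    and "((\<lambda>z :: real. ((\<Prod>c\<in>#A. 1 - z ^ c) - 1) / z ^ l) \<longlongrightarrow> 0) (at_right 0)"
proof -
  let ?lim = "\<lambda>A. ((\<lambda>z :: real. (\<Prod>c\<in>#A. 1 - z ^ c)) \<longlongrightarrow> 1) (at_right 0) \<and>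
    ((\<lambda>z :: real. ((\<Prod>c\<in>#A. 1 - z ^ c) - 1) / z ^ l) \<longlongrightarrow> 0) (at_right 0)"
  have "?lim A"
    using assms
  proof (induction A)
    case (add c A)
    let ?P = "\<lambda>z :: real. (\<Prod>c\<in>#A. 1 - z ^ c)"
    have c: "l < c" and lim: "(?P \<longlongrightarrow> 1) (at_right 0)"
      "((\<lambda>z. (?P z - 1) / z ^ l) \<longlongrightarrow> 0) (at_right 0)"
      using add by auto
    have "((\<lambda>z. (1 - z ^ c) * ?P z) \<longlongrightarrow> (1 - 0 ^ c) * 1) (at_right 0)"
      by (intro tendsto_intros lim)
    then have "((\<lambda>z :: real. (\<Prod>c\<in>#add_mset c A. 1 - z ^ c)) \<longlongrightarrow> 1) (at_right 0)"
      using c by (simp add: zero_power)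
    moreover have "((\<lambda>z. (?P z - 1) / z ^ l - z ^ c / z ^ l * ?P z) \<longlongrightarrow> 0 - 0 * 1) (at_right 0)"
      by (intro tendsto_intros lim tendsto_power_quotient c)
    then have "((\<lambda>z :: real. ((\<Prod>c\<in>#add_mset c A. 1 - z ^ c) - 1) / z ^ l) \<longlongrightarrow> 0) (at_right 0)"
      by (simp add: algebra_simps diff_divide_distrib add_divide_distrib)
    ultimately show ?case ..
  qed simp
  then show "((\<lambda>z :: real. (\<Prod>c\<in>#A. 1 - z ^ c)) \<longlongrightarrow> 1) (at_right 0)"
    "((\<lambda>z :: real. ((\<Prod>c\<in>#A. 1 - z ^ c) - 1) / z ^ l) \<longlongrightarrow> 0) (at_right 0)"
    by simp_all
qed

text \<open>Terms with exponent above \<open>l\<close> are of higher order; each term with exponent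
  \<open>l\<close> contributes 1, because \<open>1 + z ^ c\<close> tends to 1.\<close>

lemma tendsto_sum_mset_power:
  assumes "\<forall>c\<in>#A. l \<le> (c :: nat)" "0 < l"
  shows "((\<lambda>z :: real. (\<Sum>c\<in>#A. z ^ c / (1 + z ^ c)) / z ^ l) \<longlongrightarrow> count A l) (at_right 0)"
  using assms(1)
proof (induction A)
  case (add c A)
  then have c: "l \<le> c" by simp
  then have c0: "0 < c" using assms(2) by simp
  have "((\<lambda>z :: real. z ^ c / z ^ l) \<longlongrightarrow> (if c = l then 1 else 0)) (at_right 0)"
  proof (cases "c = l")
    case True
    have "eventually (\<lambda>z :: real. 1 = z ^ c / z ^ l) (at_right 0)"
      using True by (auto simp: eventually_at_right_field intro!: exI[of _ 1])
    then show ?thesis using True by (simp add: tendsto_eventually eventually_mono)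
  next
    case False
    then show ?thesis using c tendsto_power_quotient[of l c] by simp
  qed
  then have "((\<lambda>z :: real. z ^ c / z ^ l * (1 / (1 + z ^ c)) + (\<Sum>c\<in>#A. z ^ c / (1 + z ^ c)) / z ^ l)
      \<longlongrightarrow> (if c = l then 1 else 0) * (1 / (1 + 0 ^ c)) + count A l) (at_right 0)"
    using add c0 by (intro tendsto_intros) (auto simp: zero_power)
  moreover have "z ^ c / z ^ l * (1 / (1 + z ^ c)) + (\<Sum>c\<in>#A. z ^ c / (1 + z ^ c)) / z ^ l
      = (\<Sum>c\<in>#add_mset c A. z ^ c / (1 + z ^ c)) / z ^ l" for z :: real
    by (simp add: add_divide_distrib)
  ultimately show ?case using c0 by (simp add: zero_power split: if_splits)
qed simp

text \<open>The determinant of a rose stripped of the factors that depend only on the number of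
  petals and of vertices. \<open>C\<close> holds the cycle lengths, one more than the petal
  lengths.\<close>

definition rose_fun :: "nat \<Rightarrow> nat multiset \<Rightarrow> real \<Rightarrow> real" where
  "rose_fun k C z = (\<Prod>c\<in>#C. 1 - z ^ (2 * c)) *
     (1 + (2 * real k - 1) * z - 2 * (1 + z) * (\<Sum>c\<in>#C. z ^ c / (1 + z ^ c)))"

text \<open>Up to \<open>o(z ^ l)\<close> each side is \<open>g z\<close> minus
  \<open>2 z ^ l\<close> times the multiplicity of \<open>l\<close>: the product has exponents
  \<open>2 * c > l\<close>, so only the sum is visible at this order.\<close>

lemma tendsto_rose_difference:
  assumes A: "\<forall>c\<in>#A. l \<le> c" and B: "\<forall>c\<in>#B. l \<le> c" and l: "0 < l"
    and g: "(g \<longlongrightarrow> g0) (at_right 0)"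
  defines "P \<equiv> (\<lambda>A (z :: real). \<Prod>c\<in>#A. 1 - z ^ (2 * c))"
    and "S \<equiv> (\<lambda>A (z :: real). \<Sum>c\<in>#A. z ^ c / (1 + z ^ c))"
  assumes eq: "\<And>z. 0 < z \<Longrightarrow> z < 1 \<Longrightarrow>
    P A z * (g z - 2 * (1 + z) * S A z) = P B z * (g z - 2 * (1 + z) * S B z)"
  shows "count A l = count B l"
proof -
  have P: "(P A \<longlongrightarrow> 1) (at_right 0)" "((\<lambda>z. (P A z - 1) / z ^ l) \<longlongrightarrow> 0) (at_right 0)"
    if "\<forall>c\<in>#A. l \<le> c" for A
    using tendsto_prod_mset_power[of "image_mset ((*) 2) A" l] that l
    by (auto simp: P_def image_mset.compositionality comp_def) force+
  have S: "((\<lambda>z. S A z / z ^ l) \<longlongrightarrow> count A l) (at_right 0)" if "\<forall>c\<in>#A. l \<le> c" for A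
    using tendsto_sum_mset_power[OF that l] by (simp add: S_def)
  \<comment> \<open>This is the common expression minus \<open>g z\<close>, divided by
    \<open>z ^ l\<close>, arranged so that each piece has a limit; of \<open>g\<close> only a finite
    limit is used.\<close>
  define F where "F A z = g z * ((P A z - 1) / z ^ l) - P A z * (2 * (1 + z)) * (S A z / z ^ l)" for A z
  have F: "(F A \<longlongrightarrow> g0 * 0 - 1 * (2 * (1 + 0)) * real (count A l)) (at_right 0)" if "\<forall>c\<in>#A. l \<le> c" for A
    unfolding F_def by (intro tendsto_intros g P S that)
  have "F A z = F B z" if z: "0 < z" "z < 1" for z
  proof -
    have "F C z = (P C z * (g z - 2 * (1 + z) * S C z) - g z) / z ^ l" for C
      using z by (simp add: F_def field_simps)
    then show ?thesis using eq[OF z] by simp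
  qed
  then have "eventually (\<lambda>z. F A z = F B z) (at_right 0)"
    by (auto simp: eventually_at_right_field intro!: exI[of _ 1])
  then have "(F A \<longlongrightarrow> g0 * 0 - 1 * (2 * (1 + 0)) * real (count B l)) (at_right 0)"
    using F[OF B] by (simp add: tendsto_cong)
  then have "g0 * 0 - 1 * (2 * (1 + 0)) * real (count A l) = g0 * 0 - 1 * (2 * (1 + 0)) * real (count B l)"
    using F[OF A] tendsto_unique[of "at_right (0 :: real)"] trivial_limit_at_right_real by blast
  then show ?thesis by simp
qed

text \<open>After cancelling the common part, the smallest length occurs on one side only; as \<open>z\<close> tends
  to \<open>0\<close> it is visible in the coefficient of that power of \<open>z\<close>.\<close>

lemma rose_fun_inj:
  assumes pos: "\<forall>c\<in>#C. 0 < c" "\<forall>c\<in>#D. 0 < c"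
    and eq: "\<And>z. 0 < z \<Longrightarrow> z < 1 \<Longrightarrow> rose_fun k C z = rose_fun k D z"
  shows "C = D"
proof (rule ccontr)
  assume "C \<noteq> D"
  define M A B where "M = C \<inter># D" and "A = C - M" and "B = D - M"
  have C: "C = M + A" and D: "D = M + B" by (auto simp: M_def A_def B_def intro!: multiset_eqI)
  have disj: "A \<inter># B = {#}"
    by (rule multiset_eqI) (auto simp: A_def B_def M_def)
  have ne: "A + B \<noteq> {#}" using \<open>C \<noteq> D\<close> C D by auto
  define l where "l = Min (set_mset (A + B))"
  have l: "l \<in># A + B" using ne by (simp add: l_def del: set_mset_union)
  have min: "\<forall>c\<in>#A. l \<le> c" "\<forall>c\<in>#B. l \<le> c"
    by (auto simp: l_def)
  have "0 < l" using l pos C D by auto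
  let ?S = "\<lambda>A (z :: real). \<Sum>c\<in>#A. z ^ c / (1 + z ^ c)"
  let ?P = "\<lambda>A (z :: real). \<Prod>c\<in>#A. 1 - z ^ (2 * c)"
  \<comment> \<open>The sum over the common part \<open>M\<close> is absorbed into \<open>g\<close>;
    the product over \<open>M\<close> is nonzero on the interval and cancels.\<close>
  let ?g = "\<lambda>z. 1 + (2 * real k - 1) * z - 2 * (1 + z) * ?S M z"
  have "count A l = count B l"
  proof (rule tendsto_rose_difference[OF min \<open>0 < l\<close>])
    have "(?S M \<longlongrightarrow> (\<Sum>c\<in>#M. 0)) (at_right 0)"
    proof -
      have "\<forall>c\<in>#M. 0 < c" using pos C by auto
      then show ?thesis
      proof (induction M)
        case (add c M)
        have "((\<lambda>z :: real. z ^ c / (1 + z ^ c) + ?S M z) \<longlongrightarrow> 0 ^ c / (1 + 0 ^ c) + (\<Sum>c\<in>#M. 0)) (at_right 0)"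
          using add by (intro tendsto_add tendsto_divide tendsto_intros) (auto simp: zero_power)
        then show ?case using add by (simp add: zero_power)
      qed simp
    qed
    then show "(?g \<longlongrightarrow> 1 + (2 * real k - 1) * 0 - 2 * (1 + 0) * (\<Sum>c\<in>#M. 0)) (at_right 0)"
      by (intro tendsto_intros)
    show "?P A z * (?g z - 2 * (1 + z) * ?S A z) = ?P B z * (?g z - 2 * (1 + z) * ?S B z)"
      if z: "0 < z" "z < 1" for z
    proof -
      have "?P M z \<noteq> 0"
      proof -
        have "\<forall>c\<in>#M. 0 < c" using pos C by auto
        then have "z ^ (2 * c) < 1" if "c \<in># M" for c
          using z that by (simp add: power_less_one_iff)
        then show ?thesis by (fastforce simp: prod_mset_zero_iff)
      qed
      moreover have "?P M z * (?P A z * (?g z - 2 * (1 + z) * ?S A z))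
          = ?P M z * (?P B z * (?g z - 2 * (1 + z) * ?S B z))"
      proof -
        have alg: "a * b * (d - t * (s + s')) = a * (b * (d - t * s - t * s'))" for a b d t s s' :: real
          by (simp add: algebra_simps)
        have "rose_fun k (M + X) z = ?P M z * (?P X z * (?g z - 2 * (1 + z) * ?S X z))" for X
          unfolding rose_fun_def image_mset_union sum_mset.union prod_mset.union by (rule alg)
        then show ?thesis using eq[OF z] by (simp only: C D)
      qed
      ultimately show ?thesis by (rule mult_left_cancel[THEN iffD1])
    qed
  qed
  moreover have "l \<in># A \<and> l \<notin># B \<or> l \<in># B \<and> l \<notin># A"
    using l disj by (auto simp: disjunct_not_in)
  ultimately show False by (metis count_eq_zero_iff)
qed

subsection \<open>Power sums of eigenvalues as traces\<close>

definition mtrace :: "'a :: comm_monoid_add mat \<Rightarrow> 'a" where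
  "mtrace A = (\<Sum>i<dim_row A. A $$ (i, i))"

lemma mtrace_mult_commute:
  fixes A B :: "'a :: comm_semiring_0 mat"
  assumes "A \<in> carrier_mat n m" "B \<in> carrier_mat m n"
  shows "mtrace (A * B) = mtrace (B * A)"
proof -
  have "mtrace (A * B) = (\<Sum>i<n. \<Sum>j<m. A $$ (i, j) * B $$ (j, i))"
    using assms by (auto simp: mtrace_def scalar_prod_def lessThan_atLeast0 intro!: sum.cong)
  also have "\<dots> = (\<Sum>j<m. \<Sum>i<n. A $$ (i, j) * B $$ (j, i))" by (rule sum.swap)
  also have "\<dots> = mtrace (B * A)"
    using assms by (auto simp: mtrace_def scalar_prod_def lessThan_atLeast0 mult.commute intro!: sum.cong)
  finally show ?thesis .
qed

lemma upper_triangular_pow: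
  fixes B :: "'a :: comm_ring_1 mat"
  assumes B: "B \<in> carrier_mat n n" "upper_triangular B"
  shows "upper_triangular (B ^\<^sub>m k) \<and> (\<forall>i<n. (B ^\<^sub>m k) $$ (i, i) = B $$ (i, i) ^ k)"
proof (induction k)
  case 0
  then show ?case using B by auto
next
  case (Suc k)
  let ?C = "B ^\<^sub>m k"
  have C: "?C \<in> carrier_mat n n" using B by (simp add: pow_carrier_mat)
  have z: "?C $$ (i, j) = 0" "B $$ (i, j) = 0" if "j < i" "i < n" for i j
    using that Suc B C by (auto simp: upper_triangular_def)
  have entry: "(?C * B) $$ (i, j) = (\<Sum>l<n. ?C $$ (i, l) * B $$ (l, j))" if "i < n" "j < n" for i j
    using that B C by (auto simp: scalar_prod_def lessThan_atLeast0 intro!: sum.cong)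
  have "(?C * B) $$ (i, j) = 0" if "j < i" "i < n" for i j
  proof -
    have "?C $$ (i, l) * B $$ (l, j) = 0" if "l < n" for l
      using z(1)[of l i] z(2)[of j l] that \<open>j < i\<close> \<open>i < n\<close> by (cases "l < i") auto
    then show ?thesis using entry that by simp
  qed
  moreover have "(?C * B) $$ (i, i) = B $$ (i, i) ^ Suc k" if "i < n" for i
  proof -
    have "(\<Sum>l<n. ?C $$ (i, l) * B $$ (l, i)) = (\<Sum>l<n. if l = i then ?C $$ (i, i) * B $$ (i, i) else 0)"
    proof (rule sum.cong)
      fix l assume "l \<in> {..<n}"
      then show "?C $$ (i, l) * B $$ (l, i) = (if l = i then ?C $$ (i, i) * B $$ (i, i) else 0)"
        using z(1)[of l i] z(2)[of i l] that by (cases l i rule: linorder_cases) auto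
    qed simp
    also have "\<dots> = B $$ (i, i) ^ Suc k" using that Suc by (simp add: mult.commute)
    finally show ?thesis using entry that by simp
  qed
  ultimately show ?case using B C by (auto simp: upper_triangular_def)
qed

text \<open>Schur triangularisation: the trace is invariant under similarity, and the diagonal of a
  power of a triangular matrix consists of the powers of its diagonal.\<close>

lemma mtrace_pow_eq_sum_power:
  fixes A :: "'a :: conjugatable_ordered_field mat"
  assumes A: "A \<in> carrier_mat n n" and es: "char_poly A = (\<Prod>a\<leftarrow>es. [:- a, 1:])"
  shows "mtrace (A ^\<^sub>m k) = (\<Sum>a\<leftarrow>es. a ^ k)"
proof -
  obtain B P Q where dec: "schur_decomposition A es = (B, P, Q)"
    by (cases "schur_decomposition A es") auto
  have wit: "similar_mat_wit A B P Q" and ut: "upper_triangular B" and diag: "diag_mat B = es"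
    using schur_decomposition[OF A es dec] by auto
  have carr: "B \<in> carrier_mat n n" "P \<in> carrier_mat n n" "Q \<in> carrier_mat n n" and QP: "Q * P = 1\<^sub>m n"
    using similar_mat_witD2[OF A wit] by auto
  have Bk: "B ^\<^sub>m k \<in> carrier_mat n n" using carr by (simp add: pow_carrier_mat)
  have "similar_mat_wit (A ^\<^sub>m k) (B ^\<^sub>m k) P Q" by (rule similar_mat_wit_pow[OF wit])
  then have "A ^\<^sub>m k = P * B ^\<^sub>m k * Q" unfolding similar_mat_wit_def Let_def by auto
  then have "mtrace (A ^\<^sub>m k) = mtrace (P * (B ^\<^sub>m k * Q))"
    using carr Bk by (simp add: assoc_mult_mat[of _ n n _ n _ n])
  also have "\<dots> = mtrace (B ^\<^sub>m k * Q * P)"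
    by (rule mtrace_mult_commute[of _ n n]) (use carr Bk in auto)
  also have "B ^\<^sub>m k * Q * P = B ^\<^sub>m k"
    using carr Bk QP by (simp add: assoc_mult_mat[of _ n n _ n _ n])
  also have "mtrace (B ^\<^sub>m k) = (\<Sum>i<n. B $$ (i, i) ^ k)"
    using upper_triangular_pow[OF carr(1) ut, of k] Bk by (auto simp: mtrace_def intro!: sum.cong)
  also have "\<dots> = (\<Sum>a\<leftarrow>es. a ^ k)"
    using carr by (simp add: diag[symmetric] diag_mat_def sum_list_sum_nth lessThan_atLeast0 comp_def)
  finally show ?thesis .
qed

text \<open>Over the complex numbers the characteristic polynomial splits, so one list of roots
  serves both matrices.\<close>

lemma mtrace_pow_cong:
  fixes A B :: "complex mat"
  assumes A: "A \<in> carrier_mat n n" and B: "B \<in> carrier_mat m m" and eq: "char_poly A = char_poly B"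
  shows "mtrace (A ^\<^sub>m k) = mtrace (B ^\<^sub>m k)"
proof -
  obtain es where "char_poly A = (\<Prod>a\<leftarrow>es. [:- a, 1:])" using char_poly_factorized[OF A] by blast
  then show ?thesis using mtrace_pow_eq_sum_power[OF A, of es k] mtrace_pow_eq_sum_power[OF B, of es k] eq by simp
qed

lemma sum_set_nth: "distinct xs \<Longrightarrow> (\<Sum>u\<in>set xs. g u) = (\<Sum>i<length xs. g (xs ! i))"
  by (simp add: sum_list_distinct_conv_sum_set[symmetric] sum_list_sum_nth lessThan_atLeast0)

lemma mtrace_mat_on: "distinct xs \<Longrightarrow> mtrace (mat_on xs f) = (\<Sum>u\<in>set xs. f u u)"
  by (simp add: mtrace_def mat_on_def sum_set_nth)

lemma mat_on_mult:
  fixes f g :: "'a \<Rightarrow> 'a \<Rightarrow> 'b :: semiring_0"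
  assumes "distinct xs"
  shows "mat_on xs f * mat_on xs g = mat_on xs (\<lambda>u v. \<Sum>w\<in>set xs. f u w * g w v)"
  by (rule eq_matI)
    (auto simp: mat_on_def scalar_prod_def sum_set_nth[OF assms] lessThan_atLeast0 intro!: sum.cong)

section \<open>Traces of powers of the Laplacian, and triangles\<close>

context simple_graph
begin

definition adj :: "'a \<Rightarrow> 'a \<Rightarrow> real" where "adj u v = (if (u, v) \<in> E then 1 else 0)"

definition lap :: "'a \<Rightarrow> 'a \<Rightarrow> real" where "lap u v = (if u = v then real (deg u) else 0) - adj u v"

text \<open>Ordered triples, so every triangle counts six times, as in the trace of the cube of the
  adjacency matrix.\<close>

definition triangles :: "('a \<times> 'a \<times> 'a) set" where
  "triangles = {(u, v, w). (u, v) \<in> E \<and> (v, w) \<in> E \<and> (w, u) \<in> E}"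

lemma adj_commute: "adj u v = adj v u"
  using sym by (auto simp: adj_def dest: symD)

lemma adj_self [simp]: "adj u u = 0"
  using irrefl by (auto simp: adj_def irrefl_def)

lemma adj_square: "adj u v * adj u v = adj u v"
  by (simp add: adj_def)

lemma lap_commute: "lap u v = lap v u"
  by (auto simp: lap_def adj_commute)

lemma sum_adj: "nbrs u \<subseteq> S \<Longrightarrow> S \<subseteq> V \<Longrightarrow> (\<Sum>v\<in>S. adj u v) = deg u"
proof -
  assume S: "nbrs u \<subseteq> S" "S \<subseteq> V"
  have "(\<Sum>v\<in>S. adj u v) = (\<Sum>v\<in>nbrs u. 1)"
    using S finite_subset[OF S(2) fin] by (intro sum.mono_neutral_cong_right) (auto simp: adj_def)
  then show ?thesis by simp
qed

lemma trace_lap_1: "(\<Sum>u\<in>V. lap u u) = (\<Sum>u\<in>V. real (deg u))"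
  by (simp add: lap_def)

lemma trace_lap_2: "(\<Sum>u\<in>V. \<Sum>v\<in>V. lap u v * lap v u) = (\<Sum>u\<in>V. real (deg u) ^ 2) + (\<Sum>u\<in>V. real (deg u))"
proof -
  have "(\<Sum>v\<in>V. lap u v * lap v u) = real (deg u) ^ 2 + real (deg u)" if "u \<in> V" for u
  proof -
    have "lap u v * lap v u = (if v = u then real (deg u) ^ 2 else 0) + adj u v" for v
      using adj_square[of u v] by (auto simp: lap_def adj_commute[of v u] power2_eq_square)
    then show ?thesis using that fin by (simp add: sum.distrib sum_adj nbrs_sub)
  qed
  then show ?thesis by (simp add: sum.distrib)
qed

lemma card_triangles: "real (card triangles) = (\<Sum>u\<in>V. \<Sum>v\<in>V. \<Sum>w\<in>V. adj u v * adj v w * adj w u)"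
proof -
  have "(\<Sum>u\<in>V. \<Sum>v\<in>V. \<Sum>w\<in>V. adj u v * adj v w * adj w u)
      = (\<Sum>(u, v, w)\<in>V \<times> V \<times> V. adj u v * adj v w * adj w u)"
    by (simp add: sum.cartesian_product)
  also have "\<dots> = (\<Sum>t\<in>triangles. 1)"
    using arcs fin by (intro sum.mono_neutral_cong_right) (auto simp: triangles_def adj_def split: if_splits)
  finally show ?thesis by simp
qed

text \<open>Expand \<open>(D - A) ^ 3\<close> under the trace: \<open>D ^ 2 A\<close> has zero
  diagonal, the diagonal of \<open>A ^ 2\<close> consists of the degrees, and the trace of
  \<open>A ^ 3\<close> counts ordered triangles.\<close>

lemma trace_lap_3: "(\<Sum>u\<in>V. \<Sum>v\<in>V. (\<Sum>w\<in>V. lap u w * lap w v) * lap v u)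
  = (\<Sum>u\<in>V. real (deg u) ^ 3) + 3 * (\<Sum>u\<in>V. real (deg u) ^ 2) - real (card triangles)"
proof -
  define a2 where "a2 u v = (\<Sum>w\<in>V. adj u w * adj w v)" for u v
  have a2: "a2 u u = deg u" for u
    by (simp add: a2_def adj_commute[of _ u] adj_square sum_adj nbrs_sub)
  have sq: "(\<Sum>w\<in>V. lap u w * lap w v)
      = (if u = v then real (deg u) ^ 2 else 0) - (real (deg u) + real (deg v)) * adj u v + a2 u v"
    if "u \<in> V" "v \<in> V" for u v
  proof -
    have "lap u w * lap w v = (if w = u then if u = v then real (deg u) ^ 2 else 0 else 0)
        - (if w = u then real (deg u) * adj u v else 0) - (if w = v then real (deg v) * adj u v else 0)
        + adj u w * adj w v" for w
      by (auto simp: lap_def power2_eq_square algebra_simps)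
    then show ?thesis using that fin by (simp add: a2_def sum.distrib sum_subtractf distrib_right)
  qed
  have row: "(\<Sum>v\<in>V. (\<Sum>w\<in>V. lap u w * lap w v) * lap v u)
      = real (deg u) ^ 3 + 2 * real (deg u) ^ 2 + (\<Sum>v\<in>V. adj u v * real (deg v)) - (\<Sum>v\<in>V. adj v u * a2 u v)"
    if u: "u \<in> V" for u
  proof -
    have "(\<Sum>v\<in>V. (\<Sum>w\<in>V. lap u w * lap w v) * lap v u)
      = (\<Sum>v\<in>V. (if v = u then real (deg u) ^ 3 + real (deg u) ^ 2 else 0) + real (deg u) * adj u v
          + adj u v * real (deg v) - adj v u * a2 u v)"
    proof (rule sum.cong)
      fix v assume v: "v \<in> V"
      show "(\<Sum>w\<in>V. lap u w * lap w v) * lap v u = (if v = u then real (deg u) ^ 3 + real (deg u) ^ 2 else 0)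
          + real (deg u) * adj u v + adj u v * real (deg v) - adj v u * a2 u v"
        unfolding sq[OF u v]
        by (cases "v = u"; cases "(u, v) \<in> E")
          (simp_all add: lap_def a2 adj_commute[of v u] adj_def[of u v] power2_eq_square power3_eq_cube algebra_simps)
    qed simp
    also have "\<dots> = real (deg u) ^ 3 + 2 * real (deg u) ^ 2 + (\<Sum>v\<in>V. adj u v * real (deg v))
        - (\<Sum>v\<in>V. adj v u * a2 u v)"
      using u fin by (simp add: sum.distrib sum_subtractf sum_distrib_left[symmetric] sum_adj nbrs_sub power2_eq_square)
    finally show ?thesis .
  qed
  \<comment> \<open>Two of the three sums of squared degrees are already visible in each row; the
    third appears after exchanging the order of summation.\<close>
  have "(\<Sum>u\<in>V. \<Sum>v\<in>V. adj u v * real (deg v)) = (\<Sum>v\<in>V. \<Sum>u\<in>V. adj v u * real (deg v))"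
    by (subst sum.swap) (simp add: adj_commute)
  also have "\<dots> = (\<Sum>v\<in>V. real (deg v) ^ 2)"
    by (simp add: sum_distrib_right[symmetric] sum_adj nbrs_sub power2_eq_square)
  finally have A: "(\<Sum>u\<in>V. \<Sum>v\<in>V. adj u v * real (deg v)) = (\<Sum>v\<in>V. real (deg v) ^ 2)" .
  have "(\<Sum>u\<in>V. \<Sum>v\<in>V. adj v u * a2 u v) = (\<Sum>u\<in>V. \<Sum>v\<in>V. \<Sum>w\<in>V. adj u w * adj w v * adj v u)"
    by (simp add: a2_def sum_distrib_left mult.commute)
  also have "\<dots> = (\<Sum>u\<in>V. \<Sum>w\<in>V. \<Sum>v\<in>V. adj u w * adj w v * adj v u)"
    by (intro sum.cong refl sum.swap)
  also have "\<dots> = real (card triangles)" by (simp add: card_triangles)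
  finally have B: "(\<Sum>u\<in>V. \<Sum>v\<in>V. adj v u * a2 u v) = real (card triangles)" .
  show ?thesis using A B by (simp add: row sum.distrib sum_subtractf sum_distrib_left[symmetric])
qed

text \<open>A triangle avoiding \<open>c\<close> would exhaust the degrees of its vertices and form
  a closed set without \<open>c\<close>. So \<open>c\<close> occupies one of three positions, and in
  each the triple is fixed by the vertex following \<open>c\<close>, which has degree 2.\<close>

lemma card_triangles_rose:
  assumes conn: conn and c: "c \<in> V" and two: "\<And>v. v \<in> V - {c} \<Longrightarrow> deg v = 2"
  shows "card triangles \<le> 3 * deg c"
proof -
  define S where "S = Sigma (nbrs c) (\<lambda>v. nbrs v - {c})"
  have "card S = (\<Sum>v\<in>nbrs c. card (nbrs v - {c}))"
    unfolding S_def by (rule card_SigmaI) (auto simp: fin_nbrs)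
  also have "\<dots> = (\<Sum>v\<in>nbrs c. 1)"
  proof (rule sum.cong)
    fix v assume v: "v \<in> nbrs c"
    then have "v \<in> V - {c}" using nbrs_sub not_self by blast
    then show "card (nbrs v - {c}) = 1" using two v nbrs_commute[of v c] fin_nbrs by simp
  qed simp
  finally have S: "card S = deg c" by simp
  have fS: "finite S" unfolding S_def by (auto simp: fin_nbrs)
  have "triangles \<subseteq> (\<lambda>(v, w). (c, v, w)) ` S \<union> (\<lambda>(v, w). (w, c, v)) ` S \<union> (\<lambda>(v, w). (v, w, c)) ` S"
  proof (rule subsetI, rule ccontr)
    fix t
    assume t: "t \<in> triangles"
      and "t \<notin> (\<lambda>(v, w). (c, v, w)) ` S \<union> (\<lambda>(v, w). (w, c, v)) ` S \<union> (\<lambda>(v, w). (v, w, c)) ` S"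
    moreover obtain u v w where t': "t = (u, v, w)" by (cases t)
    moreover have E: "(u, v) \<in> E" "(v, w) \<in> E" "(w, u) \<in> E" "u \<noteq> v" "v \<noteq> w" "w \<noteq> u"
      using t t' irrefl by (auto simp: triangles_def irrefl_def)
    ultimately have nc: "u \<noteq> c" "v \<noteq> c" "w \<noteq> c" by (auto simp: S_def image_iff)
    have pair: "nbrs x = {y, y'}" if "x \<noteq> c" "(x, y) \<in> E" "(x, y') \<in> E" "y \<noteq> y'" for x y y'
    proof -
      have "card (nbrs x) = 2" using two that arcs by blast
      then show ?thesis using that by (intro card_subset_eq[symmetric]) (auto simp: fin_nbrs)
    qed
    have rev: "(v, u) \<in> E" "(w, v) \<in> E" "(u, w) \<in> E" using E sym by (auto dest: symD)
    have "E `` {u, v, w} = nbrs u \<union> nbrs v \<union> nbrs w" by auto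
    also have "\<dots> = {u, v, w}"
      using pair[of u v w] pair[of v u w] pair[of w u v] nc E rev by auto
    finally have "E `` {u, v, w} \<subseteq> {u, v, w}" by simp
    moreover have "{u, v, w} \<subseteq> V" using E arcs by auto
    ultimately have "{u, v, w} = V" using conn unfolding conn_def by blast
    then show False using c nc by auto
  qed
  then have "card triangles \<le> card ((\<lambda>(v, w). (c, v, w)) ` S \<union> (\<lambda>(v, w). (w, c, v)) ` S \<union> (\<lambda>(v, w). (v, w, c)) ` S)"
    using fS by (intro card_mono) auto
  also have "\<dots> \<le> card S + card S + card S"
    by (intro order.trans[OF card_Un_le] add_mono card_image_le fS)
  finally show ?thesis using S by simp
qed

end

subsection \<open>The degree sequence\<close>

text \<open>If no entry reached \<open>s\<close>, summing \<open>x (x + 1) (s - 1 - x) \<ge> 0\<close> would contradict the bound on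
  the cubes.\<close>

lemma power_sums_concentrated:
  fixes x :: "'a \<Rightarrow> int"
  assumes fin: "finite V" and s: "4 \<le> s"
    and sums: "(\<Sum>v\<in>V. x v) = s" "(\<Sum>v\<in>V. x v ^ 2) = s ^ 2" "s ^ 3 - 3 * s - 6 \<le> (\<Sum>v\<in>V. x v ^ 3)"
  shows "\<exists>v\<in>V. x v = s \<and> (\<forall>u\<in>V - {v}. x u = 0)"
proof -
  have "\<exists>v\<in>V. s \<le> x v"
  proof (rule ccontr)
    assume "\<not> ?thesis"
    then have lt: "x v \<le> s - 1" if "v \<in> V" for v using that by force
    have "0 \<le> x v * (x v + 1) * (s - 1 - x v)" if "v \<in> V" for v
    proof -
      \<comment> \<open>Integrality matters here: no integer lies strictly between -1 and 0.\<close>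
      have "0 \<le> x v * (x v + 1)" by (cases "0 \<le> x v") (auto simp: zero_le_mult_iff)
      then show ?thesis using lt[OF that] mult_nonneg_nonneg[of "x v * (x v + 1)" "s - 1 - x v"] by simp
    qed
    then have "0 \<le> (\<Sum>v\<in>V. x v * (x v + 1) * (s - 1 - x v))" by (rule sum_nonneg)
    also have "\<dots> = (\<Sum>v\<in>V. (s - 1) * x v + (s - 2) * x v ^ 2 - x v ^ 3)"
      by (intro sum.cong) (auto simp: algebra_simps power2_eq_square power3_eq_cube)
    also have "\<dots> = (s - 1) * s + (s - 2) * s ^ 2 - (\<Sum>v\<in>V. x v ^ 3)"
      by (simp add: sum.distrib sum_subtractf sum_distrib_left[symmetric] sums)
    also have "\<dots> \<le> (s - 1) * s + (s - 2) * s ^ 2 - (s ^ 3 - 3 * s - 6)" using sums(3) by simp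
    also have "\<dots> = 6 - s * (s - 2)" by (simp add: algebra_simps power2_eq_square power3_eq_cube)
    \<comment> \<open>From \<open>4 <= s\<close> the product \<open>s * (s - 2)\<close> is at least
      8, which exceeds 6.\<close>
    also have "\<dots> \<le> 6 - 4 * 2" using s mult_mono[of 4 s 2 "s - 2"] by simp
    finally show False by simp
  qed
  then obtain v where v: "v \<in> V" "s \<le> x v" by blast
  have split: "(\<Sum>u\<in>V. x u ^ 2) = x v ^ 2 + (\<Sum>u\<in>V - {v}. x u ^ 2)"
    using fin v by (simp add: sum.remove)
  have nn: "0 \<le> (\<Sum>u\<in>V - {v}. x u ^ 2)" by (intro sum_nonneg) auto
  \<comment> \<open>A single entry of size at least \<open>s\<close> uses up the whole sum of
    squares.\<close>
  have "s ^ 2 \<le> x v ^ 2" using v s by (intro power_mono) auto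
  then have "x v ^ 2 = s ^ 2" and zero: "(\<Sum>u\<in>V - {v}. x u ^ 2) = 0" using split nn sums by auto
  then have "x v = s" using v s by (simp add: power2_eq_iff)
  moreover have "\<forall>u\<in>V - {v}. x u = 0" using zero fin by (simp add: sum_nonneg_eq_0_iff)
  ultimately show ?thesis using v by blast
qed

subsection \<open>Characteristic polynomials\<close>

lemma char_poly_mat_on:
  fixes f :: "'a \<Rightarrow> 'a \<Rightarrow> 'b :: comm_ring_1"
  assumes "distinct xs"
  shows "char_poly (mat_on xs f) = det (mat_on xs (\<lambda>u v. [:- f u v, if u = v then 1 else 0:]))"
proof -
  have "char_poly_matrix (mat_on xs f) = mat_on xs (\<lambda>u v. [:- f u v, if u = v then 1 else 0:])"
    by (rule eq_matI) (use assms in \<open>auto simp: char_poly_matrix_def mat_on_def nth_eq_iff_index_eq\<close>)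
  then show ?thesis by (simp add: char_poly_def)
qed

lemma char_poly_mat_on_append:
  fixes f :: "'a \<Rightarrow> 'a \<Rightarrow> 'b :: idom"
  assumes "distinct (xs @ ys)" and "\<And>u v. u \<in> set xs \<Longrightarrow> v \<in> set ys \<Longrightarrow> f u v = 0"
  shows "char_poly (mat_on (xs @ ys) f) = char_poly (mat_on xs f) * char_poly (mat_on ys f)"
proof -
  let ?F = "\<lambda>u v. [:- f u v, if u = v then 1 else 0:]"
  have "char_poly (mat_on (xs @ ys) f) = det (mat_on (xs @ ys) ?F)"
    using assms(1) by (rule char_poly_mat_on)
  also have "\<dots> = det (mat_on xs ?F) * det (mat_on ys ?F)"
    by (rule det_mat_on_append) (use assms in auto)
  finally show ?thesis using assms(1) by (simp add: char_poly_mat_on)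
qed

lemma poly_char_poly_mat_on:
  fixes f :: "'a \<Rightarrow> 'a \<Rightarrow> real"
  assumes "distinct xs"
  shows "poly (char_poly (mat_on xs f)) x
    = (-1) ^ length xs * det (mat_on xs (\<lambda>u v. f u v - (if u = v then x else 0)))"
proof -
  let ?M = "mat_on xs (\<lambda>u v. f u v - (if u = v then x else 0))"
  have "- char_matrix (mat_on xs f) x = (-1) \<cdot>\<^sub>m ?M"
    by (rule eq_matI) (use assms in \<open>auto simp: char_matrix_def mat_on_def nth_eq_iff_index_eq\<close>)
  then have "poly (char_poly (mat_on xs f)) x = det ((-1) \<cdot>\<^sub>m ?M)"
    by (simp only: char_poly_matrix[OF mat_on_carrier])
  also have "\<dots> = (-1) ^ length xs * det ?M" by (simp add: mat_on_def)
  finally show ?thesis .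
qed

section \<open>The characteristic polynomial of the Laplacian\<close>

context simple_graph
begin

text \<open>The all-ones vector lies in the kernel: closedness keeps all neighbours, hence the full
  degree, within \<open>ys\<close>.\<close>

lemma char_poly_lap_root:
  assumes "set ys \<subseteq> V" "ys \<noteq> []" "E `` set ys \<subseteq> set ys" "distinct ys"
  shows "poly (char_poly (mat_on ys lap)) 0 = 0"
proof -
  let ?n = "length ys" and ?one = "vec (length ys) (\<lambda>_. 1 :: real)"
  have row: "(\<Sum>j<?n. lap (ys ! i) (ys ! j)) = 0" if i: "i < ?n" for i
  proof -
    have u: "ys ! i \<in> set ys" using i by simp
    have "(\<Sum>j<?n. lap (ys ! i) (ys ! j)) = (\<Sum>v\<in>set ys. lap (ys ! i) v)"
      by (rule sum_set_nth[OF assms(4), symmetric])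
    also have "\<dots> = real (deg (ys ! i)) - (\<Sum>v\<in>set ys. adj (ys ! i) v)"
      using u by (simp add: lap_def sum_subtractf)
    also have "\<dots> = 0" using assms u by (subst sum_adj) auto
    finally show ?thesis .
  qed
  have "eigenvector (mat_on ys lap) ?one 0"
    unfolding eigenvector_def
  proof (intro conjI)
    show "?one \<noteq> 0\<^sub>v (dim_row (mat_on ys lap))"
      using assms(2) by (auto simp: mat_on_def vec_eq_iff)
    show "mat_on ys lap *\<^sub>v ?one = 0 \<cdot>\<^sub>v ?one"
      by (rule eq_vecI) (use row in \<open>auto simp: mat_on_def scalar_prod_def lessThan_atLeast0\<close>)
  qed (simp add: mat_on_def)
  then show ?thesis using eigenvalue_root_char_poly[OF mat_on_carrier] by (auto simp: eigenvalue_def)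
qed

text \<open>By symmetry the complement of a closed set is closed too, so the Laplacian is block
  diagonal and each block contributes a root 0.\<close>

lemma not_conn_char_poly:
  assumes "\<not> conn"
  shows "\<exists>xs. distinct xs \<and> set xs = V \<and> [:0, 1:] ^ 2 dvd char_poly (mat_on xs lap)"
proof -
  obtain S where S: "S \<subseteq> V" "S \<noteq> {}" "E `` S \<subseteq> S" "S \<noteq> V" using assms by (auto simp: conn_def)
  have "u \<in> S" if "v \<in> S" "(u, v) \<in> E" for u v
    using that S(3) symD[OF sym] by blast
  then have T: "V - S \<subseteq> V" "V - S \<noteq> {}" "E `` (V - S) \<subseteq> V - S"
    using S(1,4) arcs by auto
  obtain ys where ys: "set ys = S" "distinct ys" using finite_distinct_list finite_subset[OF S(1) fin] by blast
  obtain zs where zs: "set zs = V - S" "distinct zs" using finite_distinct_list fin by blast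
  have "lap u v = 0" if "u \<in> set ys" "v \<in> set zs" for u v
    using that ys zs S by (auto simp: lap_def adj_def)
  then have "char_poly (mat_on (ys @ zs) lap) = char_poly (mat_on ys lap) * char_poly (mat_on zs lap)"
    using ys zs by (intro char_poly_mat_on_append) auto
  moreover have "poly (char_poly (mat_on ys lap)) 0 = 0"
  proof (rule char_poly_lap_root)
    show "E `` set ys \<subseteq> set ys" using S(3) unfolding ys(1) .
  qed (use ys S(1,2) in auto)
  moreover have "poly (char_poly (mat_on zs lap)) 0 = 0"
  proof (rule char_poly_lap_root)
    show "E `` set zs \<subseteq> set zs" using T(3) unfolding zs(1) .
  qed (use zs T(1,2) in auto)
  ultimately have prod: "char_poly (mat_on (ys @ zs) lap) = char_poly (mat_on ys lap) * char_poly (mat_on zs lap)"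
    and "[:0, 1:] dvd char_poly (mat_on ys lap)" "[:0, 1:] dvd char_poly (mat_on zs lap)"
    by (simp_all add: poly_eq_0_iff_dvd)
  then have "[:0, 1:] ^ 2 dvd char_poly (mat_on (ys @ zs) lap)"
    by (simp add: prod power2_eq_square mult_dvd_mono del: mult_pCons_left mult_pCons_right)
  moreover have "distinct (ys @ zs)" "set (ys @ zs) = V" using ys zs S by auto
  ultimately show ?thesis by blast
qed

lemma det_lap_rose:
  assumes pss: "petals c pss" "set (c # concat pss) = V"
    and two: "\<And>v. v \<in> V - {c} \<Longrightarrow> deg v = 2" and z: "0 < z" "z < 1"
  shows "det (mat_on (c # concat pss) (\<lambda>u v. lap u v - (if u = v then 2 - (z + 1 / z) else 0)))
    = (\<Prod>m\<leftarrow>map length pss. qsinh z (Suc m) / qsinh z 1)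
      * (2 * real (length pss) - 2 + z + 1 / z - (\<Sum>m\<leftarrow>map length pss. petal_weight z m))"
proof -
  let ?f = "\<lambda>u v. lap u v - (if u = v then 2 - (z + 1 / z) else 0)"
  have p: "petal c p" if "p \<in> set pss" for p using pss that by (auto simp: petals_def)
  have cn: "p ! i \<noteq> c" if "p \<in> set pss" "i < length p" for p i
    using p[OF that(1)] nth_mem[OF that(2)] by (auto simp: petal_def)
  have "det (mat_on (c # concat pss) ?f) = (\<Prod>m\<leftarrow>map length pss. qsinh z (Suc m) / qsinh z 1)
    * (?f c c - (\<Sum>m\<leftarrow>map length pss. petal_weight z m))"
  proof (rule det_rose[OF z])
    show "distinct (c # concat pss)" using pss by (simp add: petals_def)
    show "2 \<le> length p" if "p \<in> set pss" for p using p[OF that] by (simp add: petal_def)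
    show "?f u v = 0 \<and> ?f v u = 0" if "p \<in> set pss" "u \<in> set (concat pss) - set p" "v \<in> set p" for p u v
    proof -
      have "u \<noteq> c" using that pss by (auto simp: petals_def)
      then have "u \<notin> nbrs v" using petal_nbrs_sub[OF p[OF that(1)] that(3)] that(2) by blast
      then have "adj v u = 0" by (simp add: adj_def)
      moreover have "u \<noteq> v" using that by auto
      ultimately show ?thesis using lap_commute[of u v] by (simp add: lap_def)
    qed
    show "?f (p ! i) (p ! j) = tridiag (z + 1 / z) i j" if "p \<in> set pss" "i < length p" "j < length p" for p i j
    proof -
      have "p ! i = p ! j \<longleftrightarrow> i = j"
        using p[OF that(1)] that by (simp add: petal_def nth_eq_iff_index_eq)
      moreover have "deg (p ! i) = 2"
        using two cn[OF that(1,2)] p[OF that(1)] nth_mem[OF that(2)] by (auto simp: petal_def)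
      ultimately show ?thesis using petal_adj[OF p[OF that(1)] that(2,3)]
        by (auto simp: lap_def tridiag_def adj_def)
    qed
    show "?f (p ! i) c = (if i = 0 \<or> Suc i = length p then -1 else 0) \<and>
      ?f c (p ! i) = (if i = 0 \<or> Suc i = length p then -1 else 0)" if "p \<in> set pss" "i < length p" for p i
    proof -
      have "(p ! i, c) \<in> E \<longleftrightarrow> i = 0 \<or> Suc i = length p"
        using petal_adj_center[OF p[OF that(1)] that(2)] by simp
      then have "lap (p ! i) c = (if i = 0 \<or> Suc i = length p then -1 else 0)"
        using cn[OF that] by (simp add: lap_def adj_def)
      then show ?thesis using cn[OF that] cn[OF that, symmetric] lap_commute[of c "p ! i"] by simp
    qed
  qed
  then show ?thesis using deg_center[OF pss] by (simp add: lap_def)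
qed

end

section \<open>Order of vanishing of the rose determinant at \<open>x = 0\<close>\<close>

lemma petal_weight_le:
  assumes "0 < z" "z < 1" shows "petal_weight z m \<le> 2"
proof -
  have "0 \<le> (1 - z) * (1 - z ^ m)" using assms by (intro mult_nonneg_nonneg) (auto simp: power_le_one)
  then have "z + z ^ m \<le> 1 + z ^ Suc m" by (simp add: algebra_simps)
  then show ?thesis using assms by (simp add: petal_weight_def divide_le_eq add_pos_pos)
qed

lemma qsinh_quotient_ge:
  assumes z: "0 < z" "z < 1" shows "1 \<le> qsinh z (Suc m) / qsinh z 1"
proof -
  have "(1 / z) ^ 1 \<le> (1 / z) ^ Suc m" using z by (intro power_increasing) auto
  moreover have "z ^ Suc m \<le> z ^ 1" using z by (intro power_decreasing) auto
  ultimately have "qsinh z 1 \<le> qsinh z (Suc m)" by (simp add: qsinh_def)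
  then show ?thesis using qsinh_pos[OF z, of 1] by simp
qed

text \<open>The bound is \<open>- x\<close>. As each petal weight is at most 2, the second factor is
  at least \<open>- x\<close>, while the product is at least 1.\<close>

lemma rose_det_ge:
  assumes z: "0 < z" "z < 1"
  shows "z + 1 / z - 2 \<le> (\<Prod>m\<leftarrow>ms. qsinh z (Suc m) / qsinh z 1)
    * (2 * real (length ms) - 2 + z + 1 / z - (\<Sum>m\<leftarrow>ms. petal_weight z m))"
proof -
  have "1 \<le> (\<Prod>m\<leftarrow>ms. qsinh z (Suc m) / qsinh z 1)"
  proof (induction ms)
    case (Cons m ms)
    then show ?case
      using mult_mono[OF qsinh_quotient_ge[OF z, of m] Cons.IH] qsinh_quotient_ge[OF z, of m] by simp
  qed simp
  moreover have "(\<Sum>m\<leftarrow>ms. petal_weight z m) \<le> 2 * real (length ms)"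
    by (induction ms) (use petal_weight_le[OF z] in \<open>auto simp: algebra_simps intro: add_mono\<close>)
  moreover have "0 \<le> z + 1 / z - 2"
  proof -
    have "0 \<le> (1 - z) ^ 2 / z" using z by simp
    also have "\<dots> = z + 1 / z - 2" using z by (simp add: field_simps power2_eq_square)
    finally show ?thesis .
  qed
  ultimately show ?thesis
    using mult_mono[of 1 "\<Prod>m\<leftarrow>ms. qsinh z (Suc m) / qsinh z 1" "z + 1 / z - 2"
        "2 * real (length ms) - 2 + z + 1 / z - (\<Sum>m\<leftarrow>ms. petal_weight z m)"] by simp
qed

text \<open>Near a double zero at 0 the polynomial would be \<open>O(x ^ 2)\<close>, which
  contradicts the linear lower bound as \<open>z\<close> tends to 1 from the left, that is, as
  \<open>x\<close> tends to 0 from below.\<close>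

lemma square_not_dvd:
  fixes p :: "real poly"
  assumes ge: "\<And>z. 0 < z \<Longrightarrow> z < 1 \<Longrightarrow> z + 1 / z - 2 \<le> \<bar>poly p (2 - (z + 1 / z))\<bar>"
  shows "\<not> [:0, 1:] ^ 2 dvd p"
proof
  assume "[:0, 1:] ^ 2 dvd p"
  then obtain q where q: "p = [:0, 1:] ^ 2 * q" by (elim dvdE)
  define x where "x z = 2 - (z + 1 / z)" for z :: real
  have "1 \<le> \<bar>x z * poly q (x z)\<bar>" if z: "0 < z" "z < 1" for z
  proof -
    have "x z = - ((1 - z) ^ 2 / z)" using z by (simp add: x_def field_simps power2_eq_square)
    moreover have "0 < (1 - z) ^ 2 / z" using z by simp
    ultimately have neg: "x z < 0" by simp
    have "- x z \<le> \<bar>poly p (x z)\<bar>" using ge[OF z] by (simp add: x_def)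
    also have "\<dots> = - x z * \<bar>x z * poly q (x z)\<bar>"
      using neg by (simp add: q poly_power abs_mult power2_eq_square)
    finally show ?thesis using neg by (simp add: mult_le_cancel_left2)
  qed
  then have "eventually (\<lambda>z. 1 \<le> \<bar>x z * poly q (x z)\<bar>) (at_left 1)"
    by (auto simp: eventually_at_left_field intro!: exI[of _ 0])
  moreover have "((\<lambda>z. \<bar>x z * poly q (x z)\<bar>) \<longlongrightarrow> \<bar>x 1 * poly q (x 1)\<bar>) (at_left 1)"
  proof -
    have "(x \<longlongrightarrow> x 1) (at_left 1)" unfolding x_def by (intro tendsto_intros) auto
    then show ?thesis by (intro tendsto_intros)
  qed
  ultimately have "1 \<le> \<bar>x 1 * poly q (x 1)\<bar>"
    by (intro tendsto_lowerbound[of _ _ "at_left (1 :: real)"]) auto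
  then show False by (simp add: x_def)
qed

section \<open>The rose determinant in terms of the cycle lengths\<close>

text \<open>The last factor sees \<open>ms\<close> only through its length and sum, which agree for
  cospectral roses, so it cancels in the comparison.\<close>

lemma rose_det_eq_rose_fun:
  assumes z: "0 < z" "z < 1"
  shows "(\<Prod>m\<leftarrow>ms. qsinh z (Suc m) / qsinh z 1)
    * (2 * real (length ms) - 2 + z + 1 / z - (\<Sum>m\<leftarrow>ms. petal_weight z m))
    = rose_fun (length ms) (image_mset Suc (mset ms)) z
      * ((1 - z) / z * (1 / z) ^ (sum_list ms + length ms) / qsinh z 1 ^ length ms)"
proof -
  let ?C = "image_mset Suc (mset ms)"
  have prod: "(\<Prod>m\<leftarrow>ms. qsinh z (Suc m) / qsinh z 1)
    = (\<Prod>c\<in>#?C. 1 - z ^ (2 * c)) * ((1 / z) ^ (sum_list ms + length ms) / qsinh z 1 ^ length ms)"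
  proof (induction ms)
    case (Cons m ms)
    have "qsinh z (Suc m) = (1 - z ^ (2 * Suc m)) * (1 / z) ^ (m + 1)"
      using z by (simp add: qsinh_def field_simps power_add[symmetric] mult_2 mult_2_right)
    then show ?case using Cons.IH by (simp add: power_add mult_ac)
  qed simp
  \<comment> \<open>Giving each petal its share 2 of the constant
    \<open>2 * real (length ms)\<close> exposes the factor \<open>1 - z\<close> in every
    difference.\<close>
  have one: "2 - petal_weight z m = (1 - z) / z * (2 * z - 2 * (1 + z) * (z ^ Suc m / (1 + z ^ Suc m)))" for m
  proof -
    have "1 + z ^ Suc m > 0" using z by (intro add_pos_pos) auto
    then have "1 + z * z ^ m \<noteq> 0" by simp
    then show ?thesis using z by (simp add: petal_weight_def divide_simps) (simp add: algebra_simps)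
  qed
  have "2 * real (length ms) - (\<Sum>m\<leftarrow>ms. petal_weight z m)
    = (1 - z) / z * (2 * real (length ms) * z - 2 * (1 + z) * (\<Sum>c\<in>#?C. z ^ c / (1 + z ^ c)))"
  proof (induction ms)
    case (Cons m ms)
    have "2 * real (length (m # ms)) - (\<Sum>m\<leftarrow>m # ms. petal_weight z m)
        = (2 - petal_weight z m) + (2 * real (length ms) - (\<Sum>m\<leftarrow>ms. petal_weight z m))"
      by simp
    also have "\<dots> = (1 - z) / z * ((2 * z - 2 * (1 + z) * (z ^ Suc m / (1 + z ^ Suc m)))
      + (2 * real (length ms) * z - 2 * (1 + z) * (\<Sum>c\<in>#image_mset Suc (mset ms). z ^ c / (1 + z ^ c))))"
      unfolding one Cons.IH by (rule distrib_left[symmetric])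
    also have "(2 * z - 2 * (1 + z) * (z ^ Suc m / (1 + z ^ Suc m)))
      + (2 * real (length ms) * z - 2 * (1 + z) * (\<Sum>c\<in>#image_mset Suc (mset ms). z ^ c / (1 + z ^ c)))
      = 2 * real (length (m # ms)) * z
        - 2 * (1 + z) * (\<Sum>c\<in>#image_mset Suc (mset (m # ms)). z ^ c / (1 + z ^ c))"
    proof -
      have sum: "(\<Sum>c\<in>#image_mset Suc (mset (m # ms)). z ^ c / (1 + z ^ c))
          = z ^ Suc m / (1 + z ^ Suc m) + (\<Sum>c\<in>#image_mset Suc (mset ms). z ^ c / (1 + z ^ c))"
        and len: "real (length (m # ms)) = 1 + real (length ms)" by simp_all
      have alg: "(2 * z - t * a) + (2 * n * z - t * b) = 2 * (1 + n) * z - t * (a + b)" for a b t n :: real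
        by (simp add: algebra_simps)
      show ?thesis unfolding sum len by (rule alg)
    qed
    finally show ?case .
  qed simp
  moreover have "z + 1 / z - 2 = (1 - z) / z * (1 - z)" using z by (simp add: field_simps)
  ultimately have "2 * real (length ms) - 2 + z + 1 / z - (\<Sum>m\<leftarrow>ms. petal_weight z m)
    = (1 - z) / z * (1 - z) + (1 - z) / z * (2 * real (length ms) * z - 2 * (1 + z) * (\<Sum>c\<in>#?C. z ^ c / (1 + z ^ c)))"
    by linarith
  also have "\<dots> = (1 - z) / z * (1 + (2 * real (length ms) - 1) * z - 2 * (1 + z) * (\<Sum>c\<in>#?C. z ^ c / (1 + z ^ c)))"
    unfolding distrib_left[symmetric] by (rule arg_cong[where f = "(*) ((1 - z) / z)"]) (simp add: left_diff_distrib)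
  finally have sum: "2 * real (length ms) - 2 + z + 1 / z - (\<Sum>m\<leftarrow>ms. petal_weight z m)
    = (1 - z) / z * (1 + (2 * real (length ms) - 1) * z - 2 * (1 + z) * (\<Sum>c\<in>#?C. z ^ c / (1 + z ^ c)))" .
  have "a * (b / d) * (w * r) = a * r * (w * b / d)" for a b d w r :: real
    by simp
  then show ?thesis unfolding prod rose_fun_def sum .
qed

lemma rose_det_inj:
  assumes len: "length ms = length ms'" and sum: "sum_list ms = sum_list ms'"
    and eq: "\<And>z. 0 < z \<Longrightarrow> z < 1 \<Longrightarrow>
      (\<Prod>m\<leftarrow>ms. qsinh z (Suc m) / qsinh z 1)
        * (2 * real (length ms) - 2 + z + 1 / z - (\<Sum>m\<leftarrow>ms. petal_weight z m))
      = (\<Prod>m\<leftarrow>ms'. qsinh z (Suc m) / qsinh z 1)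
        * (2 * real (length ms') - 2 + z + 1 / z - (\<Sum>m\<leftarrow>ms'. petal_weight z m))"
  shows "mset ms = mset ms'"
proof -
  have "image_mset Suc (mset ms) = image_mset Suc (mset ms')"
  proof (rule rose_fun_inj[where k = "length ms"])
    fix z :: real assume z: "0 < z" "z < 1"
    let ?K = "(1 - z) / z * (1 / z) ^ (sum_list ms + length ms) / qsinh z 1 ^ length ms"
    have "?K \<noteq> 0" using z qsinh_pos[OF z, of 1] by simp
    moreover have "rose_fun (length ms) (image_mset Suc (mset ms)) z * ?K
        = rose_fun (length ms) (image_mset Suc (mset ms')) z * ?K"
      using eq[OF z] unfolding rose_det_eq_rose_fun[OF z] by (simp only: len sum)
    ultimately show "rose_fun (length ms) (image_mset Suc (mset ms)) z
        = rose_fun (length ms) (image_mset Suc (mset ms')) z" by (rule mult_right_cancel[THEN iffD1])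
  qed auto
  then show ?thesis using injD[OF multiset.inj_map[OF inj_Suc]] by blast
qed

subsection \<open>Isomorphism of roses\<close>

text \<open>Reordering changes neither the length nor the set of the concatenation, so distinctness
  follows by counting.\<close>

lemma (in simple_graph) petals_sort:
  assumes "petals c pss"
  shows "petals c (sort_key length pss)"
proof -
  have len: "length (concat qss) = (\<Sum>m\<in>#image_mset length (mset qss). m)" for qss :: "'a list list"
    by (simp add: length_concat sum_mset_sum_list[symmetric])
  have "card (set (concat (sort_key length pss))) = length (concat (sort_key length pss))"
    using assms distinct_card[of "concat pss"] unfolding len by (simp add: petals_def len[symmetric])
  then have "distinct (concat (sort_key length pss))" by (rule card_distinct)
  then show ?thesis using assms by (auto simp: petals_def)
qed

text \<open>Vertices are matched by position. The neighbours of a vertex other than the centre are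
  given by positions in its petal, so they are carried over.\<close>

lemma petals_isomorphism:
  assumes G: "simple_graph V E" and H: "simple_graph V' E'"
    and pss: "simple_graph.petals V E c pss" "set (c # concat pss) = V"
    and pss': "simple_graph.petals V' E' c' pss'" "set (c' # concat pss') = V'"
    and len: "map length pss = map length pss'"
  shows "\<exists>f. bij_betw f V V' \<and> (\<forall>u\<in>V. \<forall>v\<in>V. (u, v) \<in> E \<longleftrightarrow> (f u, f v) \<in> E')"
proof -
  interpret G: simple_graph V E by fact
  interpret H: simple_graph V' E' by fact
  let ?xs = "c # concat pss" and ?ys = "c' # concat pss'"
  have dist: "distinct ?xs" "distinct ?ys" using pss pss' by (auto simp: G.petals_def H.petals_def)
  have lxy: "length ?xs = length ?ys" by (simp add: length_concat len)
  define f where "f u = the (map_of (zip ?xs ?ys) u)" for u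
  have map: "map f ?xs = ?ys"
  proof (rule nth_equalityI)
    fix i assume "i < length (map f ?xs)"
    then have i: "i < length ?xs" by simp
    then show "map f ?xs ! i = ?ys ! i"
      using map_of_zip_nth[OF lxy dist(1), of i] lxy by (simp only: nth_map f_def option.sel)
  qed (use lxy in simp)
  then have fc: "f c = c'" and "concat (map (map f) pss) = concat pss'" by (simp_all add: map_concat)
  moreover have "length (map (map f) pss) = length pss'" using len by (metis length_map)
  moreover have "\<forall>(x, y)\<in>set (zip (map (map f) pss) pss'). length x = length y"
  proof (clarsimp simp: set_zip)
    fix i assume "i < length pss" "i < length pss'"
    then show "length (pss ! i) = length (pss' ! i)" using len by (metis nth_map)
  qed
  ultimately have maps: "map (map f) pss = pss'" by (intro concat_injective) auto
  have inj: "inj_on f V" using map dist(2) pss(2) by (metis distinct_map)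
  have "f ` V = V'" using map pss(2) pss'(2) by (metis set_map)
  then have bij: "bij_betw f V V'" using inj by (simp add: bij_betw_def)
  have nbrs: "H.nbrs (f u) = f ` G.nbrs u" if u: "u \<in> V" "u \<noteq> c" for u
  proof -
    obtain p where p: "p \<in> set pss" "u \<in> set p" using u pss(2) by auto
    then obtain i where i: "i < length p" "u = p ! i" by (metis in_set_conv_nth)
    have "G.petal c p" using pss p by (simp add: G.petals_def)
    then have G: "G.nbrs u = {(c # p @ [c]) ! i, (c # p @ [c]) ! (i + 2)}"
      using i unfolding G.petal_def by blast
    have "map f p \<in> set pss'" using p maps by auto
    then have "H.petal c' (map f p)" using pss' by (simp add: H.petals_def)
    then have "H.nbrs (map f p ! i) = {(c' # map f p @ [c']) ! i, (c' # map f p @ [c']) ! (i + 2)}"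
      using i unfolding H.petal_def by auto
    moreover have "c' # map f p @ [c'] = map f (c # p @ [c])" using fc by simp
    moreover have "map f (c # p @ [c]) ! j = f ((c # p @ [c]) ! j)" if "j < length p + 2" for j
      by (rule nth_map) (use that in simp)
    ultimately have "H.nbrs (map f p ! i) = {f ((c # p @ [c]) ! i), f ((c # p @ [c]) ! (i + 2))}"
      using i by (metis add_less_cancel_right trans_less_add1)
    then show ?thesis using i unfolding G by simp
  qed
  have arc: "(u, v) \<in> E \<longleftrightarrow> (f u, f v) \<in> E'" if "u \<in> V" "v \<in> V" "u \<noteq> c" for u v
  proof -
    have "(f u, f v) \<in> E' \<longleftrightarrow> f v \<in> f ` G.nbrs u" using nbrs[OF that(1,3)] by auto
    also have "\<dots> \<longleftrightarrow> v \<in> G.nbrs u" by (rule inj_on_image_mem_iff[OF inj that(2) G.nbrs_sub])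
    finally show ?thesis by simp
  qed
  \<comment> \<open>Arcs leaving \<open>c\<close> are reversed by symmetry, and there is no loop at
    \<open>c\<close>.\<close>
  have "(u, v) \<in> E \<longleftrightarrow> (f u, f v) \<in> E'" if uv: "u \<in> V" "v \<in> V" for u v
  proof (cases "u = c")
    case True
    show ?thesis
    proof (cases "v = c")
      case True
      then show ?thesis using \<open>u = c\<close> G.irrefl H.irrefl by (auto simp: irrefl_def)
    next
      case False
      then show ?thesis using arc[OF uv(2,1)] G.sym H.sym by (meson symD)
    qed
  qed (use arc uv in blast)
  then show ?thesis using bij by blast
qed

subsection \<open>Graphs with the same Laplacian spectrum\<close>

lemma pair_graph_simple: "pair_graph G \<Longrightarrow> simple_graph (pverts G) (parcs G)"
proof -
  assume "pair_graph G"
  then interpret pair_graph G .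
  show ?thesis
  proof
    show "parcs G \<subseteq> pverts G \<times> pverts G" by (auto dest: in_arcsD1 in_arcsD2)
    show "sym (parcs G)" using pair_sym_arcs by (simp add: symmetric_def)
    show "irrefl (parcs G)" using pair_no_loops by (fastforce simp: irrefl_def)
  qed (rule pair_finite_verts)
qed

lemma vertex_degree_eq: "vertex_degree G v = card (parcs G `` {v})"
proof -
  have "out_arcs (with_proj G) v = Pair v ` (parcs G `` {v})"
    by (auto simp: out_arcs_def)
  then show ?thesis by (simp add: out_degree_def card_image inj_on_def)
qed

lemma connected_imp_conn:
  assumes "pair_graph G" and "Digraph_Component.connected (with_proj G)"
  shows "simple_graph.conn (pverts G) (parcs G)"
proof -
  interpret pair_graph G by fact
  have "strongly_connected (with_proj G)"
    using assms(2) pair_sym_arcs by (intro symmetric_connected_imp_strongly_connected) auto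
  then have reach: "(u, v) \<in> (parcs G)\<^sup>*" if "u \<in> pverts G" "v \<in> pverts G" for u v
    using that reachable_rtranclI[of "with_proj G" u v] by (auto simp: strongly_connected_def)
  show ?thesis
    unfolding simple_graph.conn_def[OF pair_graph_simple[OF assms(1)]]
  proof (intro allI impI)
    fix S assume S: "S \<subseteq> pverts G" "S \<noteq> {}" "parcs G `` S \<subseteq> S"
    then obtain u where u: "u \<in> S" by auto
    have "v \<in> S" if "(u, v) \<in> (parcs G)\<^sup>*" for v
      using that by induction (use u S(3) in auto)
    then show "S = pverts G" using reach u S(1) by blast
  qed
qed

lemma laplacian_mat_eq:
  assumes "pair_graph G" "distinct xs"
  shows "laplacian_mat G xs = mat_on xs (simple_graph.lap (parcs G))"
proof -
  interpret simple_graph "pverts G" "parcs G" using assms(1) by (rule pair_graph_simple)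
  show ?thesis
    by (rule eq_matI) (use assms(2) in \<open>auto simp: laplacian_mat_def degree_mat_def adjacency_mat_def
        mat_on_def lap_def adj_def vertex_degree_eq nth_eq_iff_index_eq\<close>)
qed

text \<open>A monic complex polynomial is determined by its multiset of roots, and embedding real
  coefficients into the complex numbers is injective.\<close>

lemma laplacian_spectrum_eq_char_poly:
  assumes G: "pair_graph G" "distinct xs" "set xs = pverts G"
    and H: "pair_graph H" "distinct ys" "set ys = pverts H"
    and eq: "laplacian_spectrum H = laplacian_spectrum G"
  shows "char_poly (mat_on ys (simple_graph.lap (parcs H))) = char_poly (mat_on xs (simple_graph.lap (parcs G)))"
proof -
  let ?A = "map_mat complex_of_real (mat_on xs (simple_graph.lap (parcs G)))"
    and ?B = "map_mat complex_of_real (mat_on ys (simple_graph.lap (parcs H)))"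
  have "proots (char_poly ?B) = proots (char_poly ?A)"
    using eq laplacian_spectrum_eq[OF G(2,3)] laplacian_spectrum_eq[OF H(2,3)]
    by (simp add: eigenvalue_mset_def laplacian_mat_eq[OF G(1,2)] laplacian_mat_eq[OF H(1,2)])
  moreover have "lead_coeff (char_poly ?A) = 1" "lead_coeff (char_poly ?B) = 1"
    using degree_monic_char_poly[of ?A "length xs"] degree_monic_char_poly[of ?B "length ys"]
    by (auto simp: mat_on_def)
  ultimately have "char_poly ?B = char_poly ?A"
    using complex_poly_decompose_multiset[of "char_poly ?A"] complex_poly_decompose_multiset[of "char_poly ?B"]
    by simp
  then have "map_poly complex_of_real (char_poly (mat_on ys (simple_graph.lap (parcs H))))
      = map_poly complex_of_real (char_poly (mat_on xs (simple_graph.lap (parcs G))))"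
    by (simp add: of_real_hom.char_poly_hom[OF mat_on_carrier])
  then show ?thesis by (auto simp: poly_eq_iff coeff_map_poly)
qed

lemma (in simple_graph) mtrace_lap:
  assumes "distinct xs" "set xs = V"
  defines "A \<equiv> map_mat complex_of_real (mat_on xs lap)"
  shows "mtrace (A ^\<^sub>m 1) = complex_of_real (\<Sum>u\<in>V. real (deg u))"
    and "mtrace (A ^\<^sub>m 2) = complex_of_real ((\<Sum>u\<in>V. real (deg u) ^ 2) + (\<Sum>u\<in>V. real (deg u)))"
    and "mtrace (A ^\<^sub>m 3) = complex_of_real ((\<Sum>u\<in>V. real (deg u) ^ 3) + 3 * (\<Sum>u\<in>V. real (deg u) ^ 2)
      - real (card triangles))"
proof -
  have A: "A = mat_on xs (\<lambda>u v. complex_of_real (lap u v))"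
    by (rule eq_matI) (auto simp: A_def mat_on_def)
  have carr: "A \<in> carrier_mat (length xs) (length xs)" by (simp add: A)
  have pow: "A ^\<^sub>m 1 = A" "A ^\<^sub>m 2 = A * A" "A ^\<^sub>m 3 = A * A * A"
    using carr by (simp_all add: numeral_2_eq_2 numeral_3_eq_3)
  show "mtrace (A ^\<^sub>m 1) = complex_of_real (\<Sum>u\<in>V. real (deg u))"
    unfolding pow unfolding A mtrace_mat_on[OF assms(1)] trace_lap_1[symmetric] assms(2) by simp
  show "mtrace (A ^\<^sub>m 2) = complex_of_real ((\<Sum>u\<in>V. real (deg u) ^ 2) + (\<Sum>u\<in>V. real (deg u)))"
    unfolding pow unfolding A mat_on_mult[OF assms(1)] mtrace_mat_on[OF assms(1)] trace_lap_2[symmetric] assms(2) by simp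
  show "mtrace (A ^\<^sub>m 3) = complex_of_real ((\<Sum>u\<in>V. real (deg u) ^ 3) + 3 * (\<Sum>u\<in>V. real (deg u) ^ 2)
      - real (card triangles))"
    unfolding pow unfolding A mat_on_mult[OF assms(1)] mtrace_mat_on[OF assms(1)] trace_lap_3[symmetric] assms(2) by simp
qed

lemma cospectral_degrees:
  assumes G: "simple_graph V E" and H: "simple_graph V' E'"
    and xs: "distinct xs" "set xs = V" and ys: "distinct ys" "set ys = V'"
    and eq: "char_poly (mat_on ys (simple_graph.lap E')) = char_poly (mat_on xs (simple_graph.lap E))"
    and k: "3 \<le> k" and conn: "simple_graph.conn V E" and c: "c \<in> V" "card (E `` {c}) = 2 * k"
    and two: "\<And>v. v \<in> V - {c} \<Longrightarrow> card (E `` {v}) = 2"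
  shows "\<exists>d\<in>V'. card (E' `` {d}) = 2 * k \<and> (\<forall>v\<in>V' - {d}. card (E' `` {v}) = 2)"
proof -
  interpret G: simple_graph V E by fact
  interpret H: simple_graph V' E' by fact
  let ?A = "map_mat complex_of_real (mat_on xs G.lap)" and ?B = "map_mat complex_of_real (mat_on ys H.lap)"
  have A: "?A \<in> carrier_mat (length xs) (length xs)" and B: "?B \<in> carrier_mat (length ys) (length ys)"
    by (auto simp: mat_on_def)
  have "length ys = length xs"
    using eq degree_monic_char_poly[OF mat_on_carrier, of ys H.lap] degree_monic_char_poly[OF mat_on_carrier, of xs G.lap]
    by simp
  \<comment> \<open>The number of vertices is the power sum of exponent 0; it is needed to shift the
    degrees by 2.\<close>
  then have n: "card V' = card V" using xs ys by (metis distinct_card)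
  have "char_poly ?B = char_poly ?A"
    using eq by (simp add: of_real_hom.char_poly_hom[OF mat_on_carrier])
  then have tr: "mtrace (?B ^\<^sub>m j) = mtrace (?A ^\<^sub>m j)" for j by (rule mtrace_pow_cong[OF B A])
  let ?d = "\<lambda>v. real (G.deg v)" and ?e = "\<lambda>v. real (H.deg v)"
  have p1: "(\<Sum>v\<in>V'. ?e v) = (\<Sum>v\<in>V. ?d v)"
    using tr[of 1] G.mtrace_lap(1)[OF xs] H.mtrace_lap(1)[OF ys] by (simp only: of_real_eq_iff)
  have p2: "(\<Sum>v\<in>V'. ?e v ^ 2) = (\<Sum>v\<in>V. ?d v ^ 2)"
    using tr[of 2] p1 unfolding G.mtrace_lap(2)[OF xs] H.mtrace_lap(2)[OF ys] of_real_eq_iff by linarith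
  have p3: "(\<Sum>v\<in>V'. ?e v ^ 3) - real (card H.triangles) = (\<Sum>v\<in>V. ?d v ^ 3) - real (card G.triangles)"
    using tr[of 3] p2 unfolding G.mtrace_lap(3)[OF xs] H.mtrace_lap(3)[OF ys] of_real_eq_iff by linarith
  have tri: "real (card G.triangles) \<le> 6 * real k"
    using G.card_triangles_rose[OF conn c(1) two] c(2) by simp
  define x where "x v = int (H.deg v) - 2" for v
  define s where "s = 2 * int k - 2"
  have cubes: "(r - 2) ^ 2 = r ^ 2 - 4 * r + 4" "(r - 2) ^ 3 = r ^ 3 - 6 * r ^ 2 + 12 * r - 8" for r :: real
    by (simp_all add: power2_eq_square power3_eq_cube algebra_simps)
  have e1: "(\<Sum>v\<in>V'. ?e v - 2) = (\<Sum>v\<in>V. ?d v - 2)"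
    by (simp add: sum_subtractf p1 n)
  have e2: "(\<Sum>v\<in>V'. (?e v - 2) ^ 2) = (\<Sum>v\<in>V. (?d v - 2) ^ 2)"
    unfolding cubes by (simp add: sum_subtractf sum.distrib sum_distrib_left[symmetric] p1 p2 n)
  \<comment> \<open>The triangles of the second graph enter with a favourable sign and are dropped;
    those of the rose cost at most \<open>6 * real k\<close>.\<close>
  have e3: "(\<Sum>v\<in>V. (?d v - 2) ^ 3) - 6 * real k \<le> (\<Sum>v\<in>V'. (?e v - 2) ^ 3)"
    unfolding cubes using p3 tri by (simp add: sum_subtractf sum.distrib sum_distrib_left[symmetric] p1 p2 n)
  \<comment> \<open>Only the centre contributes; \<open>0 < j\<close> is required because
    \<open>0 ^ 0 = 1\<close>.\<close>
  have g: "(\<Sum>v\<in>V. (?d v - 2) ^ j) = real_of_int s ^ j" if "0 < j" for j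
  proof -
    have "(\<Sum>v\<in>V. (?d v - 2) ^ j) = (?d c - 2) ^ j + (\<Sum>v\<in>V - {c}. (?d v - 2) ^ j)"
      using G.fin c(1) by (rule sum.remove)
    also have "(\<Sum>v\<in>V - {c}. (?d v - 2) ^ j) = 0"
      using two that by (intro sum.neutral) (auto simp: zero_power)
    finally show ?thesis using c(2) by (simp add: s_def)
  qed
  have xe: "real_of_int (x v) = ?e v - 2" for v by (simp add: x_def)
  have "\<exists>v\<in>V'. x v = s \<and> (\<forall>u\<in>V' - {v}. x u = 0)"
  proof (rule power_sums_concentrated[OF H.fin])
    show "4 \<le> s" using k by (simp add: s_def)
    have "real_of_int (\<Sum>v\<in>V'. x v) = real_of_int s"
      using e1 g[of 1] by (simp add: xe)
    then show "(\<Sum>v\<in>V'. x v) = s" by (simp only: of_int_eq_iff)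
    have "real_of_int (\<Sum>v\<in>V'. x v ^ 2) = real_of_int (s ^ 2)"
      using e2 g[of 2] by (simp add: xe)
    then show "(\<Sum>v\<in>V'. x v ^ 2) = s ^ 2" by (simp only: of_int_eq_iff)
    \<comment> \<open>Here \<open>3 * s + 6\<close> is \<open>6 * k\<close>, by the definition of
      \<open>s\<close>.\<close>
    have "real_of_int (s ^ 3 - 3 * s - 6) \<le> real_of_int (\<Sum>v\<in>V'. x v ^ 3)"
      using e3 g[of 3] by (simp add: xe) (simp add: s_def)
    then show "s ^ 3 - 3 * s - 6 \<le> (\<Sum>v\<in>V'. x v ^ 3)" by (simp only: of_int_le_iff)
  qed
  then obtain v where "v \<in> V'" "x v = s" "\<And>u. u \<in> V' - {v} \<Longrightarrow> x u = 0" by blast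
  then show ?thesis by (intro bexI[of _ v]) (auto simp: x_def s_def)
qed

text \<open>The hypothesis \<open>eq\<close> ranges over all enumerations because different ones are
  needed: ordered by petals for the determinants, and split along a closed set when \<open>H\<close>
  is assumed disconnected.\<close>

lemma rose_cospectral_isomorphism:
  assumes G: "simple_graph V E" and H: "simple_graph V' E'"
    and eq: "\<And>xs ys. distinct xs \<Longrightarrow> set xs = V \<Longrightarrow> distinct ys \<Longrightarrow> set ys = V' \<Longrightarrow>
      char_poly (mat_on ys (simple_graph.lap E')) = char_poly (mat_on xs (simple_graph.lap E))"
    and k: "3 \<le> k" and conn: "simple_graph.conn V E" and c: "c \<in> V" "card (E `` {c}) = 2 * k"
    and two: "\<And>v. v \<in> V - {c} \<Longrightarrow> card (E `` {v}) = 2"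
  shows "\<exists>f. bij_betw f V V' \<and> (\<forall>u\<in>V. \<forall>v\<in>V. (u, v) \<in> E \<longleftrightarrow> (f u, f v) \<in> E')"
proof -
  interpret G: simple_graph V E by fact
  interpret H: simple_graph V' E' by fact
  obtain d where d: "d \<in> V'" "H.deg d = 2 * k" "\<And>v. v \<in> V' - {d} \<Longrightarrow> H.deg v = 2"
  proof -
    obtain xs ys where "distinct xs" "set xs = V" "distinct ys" "set ys = V'"
      using finite_distinct_list G.fin H.fin by metis
    then show ?thesis using cospectral_degrees[OF G H _ _ _ _ eq k conn c two] that by blast
  qed
  obtain pss where pss: "G.petals c pss" "set (c # concat pss) = V"
    using G.ex_petals[OF conn c(1) two] by blast
  define xs where "xs = c # concat pss"
  have xs: "distinct xs" "set xs = V" using pss by (auto simp: xs_def G.petals_def)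
  have polyG: "poly (char_poly (mat_on xs G.lap)) (2 - (z + 1 / z)) = (-1) ^ length xs
      * ((\<Prod>m\<leftarrow>map length pss. qsinh z (Suc m) / qsinh z 1)
      * (2 * real (length pss) - 2 + z + 1 / z - (\<Sum>m\<leftarrow>map length pss. petal_weight z m)))"
    if "0 < z" "z < 1" for z
    unfolding poly_char_poly_mat_on[OF xs(1)] using G.det_lap_rose[OF pss two that] by (simp only: xs_def)
  have "H.conn"
  proof (rule ccontr)
    assume "\<not> H.conn"
    then obtain ys where ys: "distinct ys" "set ys = V'" "[:0, 1:] ^ 2 dvd char_poly (mat_on ys H.lap)"
      using H.not_conn_char_poly by blast
    then have "[:0, 1:] ^ 2 dvd char_poly (mat_on xs G.lap)" using eq[OF xs ys(1,2)] by simp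
    moreover have "z + 1 / z - 2 \<le> \<bar>poly (char_poly (mat_on xs G.lap)) (2 - (z + 1 / z))\<bar>"
      if z: "0 < z" "z < 1" for z
    proof -
      have "\<bar>(-1) ^ j * r\<bar> = \<bar>r\<bar>" for j and r :: real by (simp add: abs_mult)
      then show ?thesis unfolding polyG[OF z]
        using order_trans[OF rose_det_ge[OF z, of "map length pss"] abs_ge_self] by (simp only: length_map)
    qed
    ultimately show False using square_not_dvd by blast
  qed
  then obtain pss' where pss': "H.petals d pss'" "set (d # concat pss') = V'"
    using H.ex_petals[OF _ d(1,3)] by blast
  define ys where "ys = d # concat pss'"
  have ys: "distinct ys" "set ys = V'" using pss' by (auto simp: ys_def H.petals_def)
  have polyH: "poly (char_poly (mat_on ys H.lap)) (2 - (z + 1 / z)) = (-1) ^ length ys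
      * ((\<Prod>m\<leftarrow>map length pss'. qsinh z (Suc m) / qsinh z 1)
      * (2 * real (length pss') - 2 + z + 1 / z - (\<Sum>m\<leftarrow>map length pss'. petal_weight z m)))"
    if "0 < z" "z < 1" for z
    unfolding poly_char_poly_mat_on[OF ys(1)] using H.det_lap_rose[OF pss' d(3) that] by (simp only: ys_def)
  have char: "char_poly (mat_on ys H.lap) = char_poly (mat_on xs G.lap)" by (rule eq[OF xs ys])
  have len: "length ys = length xs"
    using char degree_monic_char_poly[OF mat_on_carrier, of ys H.lap] degree_monic_char_poly[OF mat_on_carrier, of xs G.lap]
    by simp
  have "mset (map length pss) = mset (map length pss')"
  proof (rule rose_det_inj)
    show "length (map length pss) = length (map length pss')"
      using G.deg_center[OF pss] H.deg_center[OF pss'] c d by simp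
    show "sum_list (map length pss) = sum_list (map length pss')"
      using len by (simp add: xs_def ys_def length_concat)
    fix z :: real assume z: "0 < z" "z < 1"
    show "(\<Prod>m\<leftarrow>map length pss. qsinh z (Suc m) / qsinh z 1)
        * (2 * real (length (map length pss)) - 2 + z + 1 / z - (\<Sum>m\<leftarrow>map length pss. petal_weight z m))
      = (\<Prod>m\<leftarrow>map length pss'. qsinh z (Suc m) / qsinh z 1)
        * (2 * real (length (map length pss')) - 2 + z + 1 / z - (\<Sum>m\<leftarrow>map length pss'. petal_weight z m))"
      using polyG[OF z] polyH[OF z] char len by simp
  qed
  \<comment> \<open>Equal multisets of lengths become equal lists once the petals are sorted by
    length, which pairs them up.\<close>
  then have "sort (map length pss) = sort (map length pss')"
    by (intro properties_for_sort) simp_all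
  moreover have "sort (map length pss) = map length (sort_key length pss)"
    by (rule properties_for_sort) simp_all
  moreover have "sort (map length pss') = map length (sort_key length pss')"
    by (rule properties_for_sort) simp_all
  ultimately have "map length (sort_key length pss) = map length (sort_key length pss')" by simp
  then show ?thesis
    by (intro petals_isomorphism[OF G H G.petals_sort[OF pss(1)] _ H.petals_sort[OF pss'(1)]])
      (use pss(2) pss'(2) in auto)
qed

lemma digraph_isoI:
  assumes G: "pair_graph G" and H: "pair_graph H" and bij: "bij_betw f (pverts G) (pverts H)"
    and arc: "\<And>u v. u \<in> pverts G \<Longrightarrow> v \<in> pverts G \<Longrightarrow> (u, v) \<in> parcs G \<longleftrightarrow> (f u, f v) \<in> parcs H"
  shows "digraph_iso (with_proj G) (with_proj H)"
proof -
  interpret G: pair_graph G by fact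
  interpret H: pair_graph H by fact
  let ?h = "\<lparr>iso_verts = f, iso_arcs = map_prod f f, iso_head = snd, iso_tail = fst\<rparr>"
  have inj: "inj_on f (pverts G)" and img: "f ` pverts G = pverts H"
    using bij by (auto simp: bij_betw_def)
  have sub: "parcs G \<subseteq> pverts G \<times> pverts G" by (auto dest: G.in_arcsD1 G.in_arcsD2)
  have "inj_on (map_prod f f) (parcs G)"
    using map_prod_inj_on[OF inj inj] sub by (rule inj_on_subset)
  then have "pre_digraph.digraph_isomorphism (with_proj G) ?h"
    using inj G.wf_digraph_axioms by (simp add: pre_digraph.digraph_isomorphism_def)
  moreover have "map_prod f f ` parcs G = parcs H"
  proof (intro equalityI subsetI)
    fix e assume "e \<in> map_prod f f ` parcs G"
    then show "e \<in> parcs H" using sub arc by auto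
  next
    fix e assume e: "e \<in> parcs H"
    obtain u' v' where e': "e = (u', v')" by (cases e)
    then obtain u v where "u \<in> pverts G" "v \<in> pverts G" "u' = f u" "v' = f v"
      using e img H.in_arcsD1 H.in_arcsD2 by blast
    then show "e \<in> map_prod f f ` parcs G" using e e' arc by (auto intro!: image_eqI[of _ _ "(u, v)"])
  qed
  then have "with_proj H = app_iso ?h (with_proj G)"
    by (simp add: app_iso_def with_proj_def img)
  ultimately show ?thesis unfolding digraph_iso_def by blast
qed

theorem theorem5p3:
  fixes G :: "'a pair_pre_digraph" and k :: nat
  assumes "k \<ge> 3" and "rose_graph k G"
  shows "determined_by_laplacian_spectrum TYPE('b) G"
  unfolding determined_by_laplacian_spectrum_def
proof (intro allI impI)
  fix H :: "'b pair_pre_digraph"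
  assume H: "pair_graph H" and spec: "laplacian_spectrum H = laplacian_spectrum G"
  have G: "pair_graph G" and conn: "Digraph_Component.connected (with_proj G)"
    using assms(2) by (auto simp: rose_graph_def)
  obtain c where c: "c \<in> pverts G" "card (parcs G `` {c}) = 2 * k"
    and two: "\<And>v. v \<in> pverts G - {c} \<Longrightarrow> card (parcs G `` {v}) = 2"
    using assms(2) by (auto simp: rose_graph_def vertex_degree_eq)
  obtain f where "bij_betw f (pverts G) (pverts H)"
    "\<forall>u\<in>pverts G. \<forall>v\<in>pverts G. (u, v) \<in> parcs G \<longleftrightarrow> (f u, f v) \<in> parcs H"
    using rose_cospectral_isomorphism[OF pair_graph_simple[OF G] pair_graph_simple[OF H]
        laplacian_spectrum_eq_char_poly[OF G _ _ H _ _ spec] assms(1) connected_imp_conn[OF G conn] c two]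
    by blast
  then show "digraph_iso (with_proj G) (with_proj H)" by (intro digraph_isoI[OF G H]) auto
qed

end
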